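(* Let $G$ be a connected graph. Then for every discrete collection $\{A_i\mid i\in I\}$ of pairwise disjoint closed subsets $A_i\subseteq\Upsilon(G)$ there exists a collection $\{O_i\mid i\in I\}$ of pairwise disjoint open subsets $O_i\subseteq|G|_\Theta$ with $A_i\subseteq O_i$ for all $i\in I$. In particular, the ultrafilter tangle space $\Upsilon(G)$ is collectionwise normal.
   Context: Notation: $G=(V,E)$; finite-order separations of $G$ ($\{A,B\}$ with $A\cup B=V$, $|A\cap B|<\infty$, no edge between $A\setminus B$ and $B\setminus A$), orientations $(A,B)$, $(B,A)$ ordered by $(A,B)\le(C,D)$ iff $A\subseteq C$, $B\supseteq D$. For finite $X\subseteq V$, $\mathcal C_X$ is the set of components of $G-X$, and for $\mathcal C\subseteq\mathcal C_X$, $(X,\mathcal C):=(V\setminus V[\mathcal C],X\cup V[\mathcal C])$ with $V[\mathcal C]$ the union of the vertex sets of the members of $\mathcal C$. An orientation $O$ of a set of separations contains exactly one orientation of each; it is consistent if there are no distinct $r,s$ with orientations $\vec r<\vec s$ such that $\overleftarrow r,\vec s\in O$ ($\overleftarrow r$ the inverse). A star is a set $\sigma$ of oriented separations with $\vec r\le\overleftarrow s$ for distinct $\vec r,\vec s\in\sigma$, its interior being $\bigcap B$ over $(A,B)\in\sigma$. An $\aleph_0$-tangle is a consistent orientation of the set of all finite-order separations of $G$ containing no finite star of finite interior; $\Theta(G)$ is the set of all $\aleph_0$-tangles. An $\aleph_0$-tangle $\tau$ is an ultrafilter tangle if for some finite $X$ the ultrafilter $U(\tau,X)=\{\mathcal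 C\subseteq\mathcal C_X:(X,\mathcal C)\in\tau\}$ on $\mathcal C_X$ is free; $\Upsilon(G)$ is the set of ultrafilter tangles. The tangle compactification $|G|_\Theta$: regard $G$ as a 1-complex (each edge $xy$ a copy of $[0,1]$ with interior $\mathring e$, vertices having as basic open neighbourhoods unions of half-open intervals $[v,i_e)$ over the edges $e$ at $v$). The point set of $|G|_\Theta$ is $G\sqcup\Theta(G)$, with topology generated by the open sets of the 1-complex $G$ together with the sets $\mathcal O(X,\mathcal C)=\bigcup\mathcal C\cup\mathring E(X,\bigcup\mathcal C)\cup\{\tau\in\Theta(G):(X,\mathcal C)\in\tau\}$ for all finite $X\subseteq V$ and $\mathcal C\subseteq\mathcal C_X$, where $\mathring E(X,\bigcup\mathcal C)$ is the set of inner points of edges between $X$ and $\bigcup\mathcal C$. $\Upsilon(G)$ carries the subspace topology. A collection $\{A_i\}$ of subsets of a space $Y$ is discrete if each point of $Y$ has an open neighbourhood meeting at most one $A_i$. A space $Y$ in which singletons are closed is collectionwise normal if for every discrete collection of pairwise disjoint closed sets $A_i$ there are pairwise disjoint open $O_i\supseteq A_i$. *)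

theory Defs
  imports "HOL-Analysis.Analysis"
begin

section \<open>Graphs\<close>

text \<open>Graphs are simple, may be infinite, and are given by a vertex set \<open>V\<close> and a set \<open>E\<close> of
  two-element subsets of \<open>V\<close>.\<close>

definition simple_graph :: "'a set \<Rightarrow> 'a set set \<Rightarrow> bool" where
  "simple_graph V E \<longleftrightarrow> (\<forall>e\<in>E. \<exists>x\<in>V. \<exists>y\<in>V. x \<noteq> y \<and> e = {x, y})"

text \<open>\<open>W\<close> need not be all of \<open>V\<close>: the path relation is that of the subgraph induced on \<open>W\<close>.\<close>

definition path_rel :: "'a set \<Rightarrow> 'a set set \<Rightarrow> ('a \<times> 'a) set" where
  "path_rel W E = {(x, y). x \<in> W \<and> y \<in> W \<and> {x, y} \<in> E}\<^sup>* \<inter> W \<times> W"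

definition connected_graph :: "'a set \<Rightarrow> 'a set set \<Rightarrow> bool" where
  "connected_graph V E \<longleftrightarrow> V \<noteq> {} \<and> (\<forall>x\<in>V. \<forall>y\<in>V. (x, y) \<in> path_rel V E)"

text \<open>The components of \<open>G - X\<close>. As they are induced subgraphs, each is represented by its vertex
  set, so that the vertex set of a collection \<open>\<C>\<close> of components is \<open>\<Union>\<C>\<close>.\<close>

definition comps :: "'a set \<Rightarrow> 'a set set \<Rightarrow> 'a set \<Rightarrow> 'a set set" where
  "comps V E X = (V - X) // path_rel (V - X) E"


section \<open>Separations and tangles\<close>

type_synonym 'a osep = "'a set \<times> 'a set"

definition unoriented :: "'a osep \<Rightarrow> 'a set set" where
  "unoriented r = {fst r, snd r}"

definition finite_order_seps :: "'a set \<Rightarrow> 'a set set \<Rightarrow> 'a set set set" where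
  "finite_order_seps V E =
     {{A, B} | A B. A \<union> B = V \<and> finite (A \<inter> B) \<and> (\<forall>a\<in>A - B. \<forall>b\<in>B - A. {a, b} \<notin> E)}"

definition sep_le :: "'a osep \<Rightarrow> 'a osep \<Rightarrow> bool" where
  "sep_le r s \<longleftrightarrow> fst r \<subseteq> fst s \<and> snd s \<subseteq> snd r"

definition sep_less :: "'a osep \<Rightarrow> 'a osep \<Rightarrow> bool" where
  "sep_less r s \<longleftrightarrow> sep_le r s \<and> r \<noteq> s"

definition orientation_of :: "'a set set set \<Rightarrow> 'a osep set \<Rightarrow> bool" where
  "orientation_of S Or \<longleftrightarrow>
     (\<forall>r\<in>Or. unoriented r \<in> S) \<and> (\<forall>s\<in>S. \<exists>!r. r \<in> Or \<and> unoriented r = s)"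

definition consistent :: "'a osep set \<Rightarrow> bool" where
  "consistent Or \<longleftrightarrow>
     \<not> (\<exists>r s. unoriented r \<noteq> unoriented s \<and> sep_less r s \<and> prod.swap r \<in> Or \<and> s \<in> Or)"

definition sep_star :: "'a osep set \<Rightarrow> bool" where
  "sep_star \<sigma> \<longleftrightarrow> (\<forall>r\<in>\<sigma>. \<forall>s\<in>\<sigma>. r \<noteq> s \<longrightarrow> sep_le r (prod.swap s))"

text \<open>The intersection is taken inside \<open>V\<close>, so the empty star has interior \<open>V\<close>, not \<open>UNIV\<close>.\<close>

definition star_interior :: "'a set \<Rightarrow> 'a osep set \<Rightarrow> 'a set" where
  "star_interior V \<sigma> = V \<inter> (\<Inter>r\<in>\<sigma>. snd r)"

definition aleph0_tangle :: "'a set \<Rightarrow> 'a set set \<Rightarrow> 'a osep set \<Rightarrow> bool" where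
  "aleph0_tangle V E \<tau> \<longleftrightarrow>
     orientation_of (finite_order_seps V E) \<tau> \<and> consistent \<tau> \<and>
     \<not> (\<exists>\<sigma>\<subseteq>\<tau>. finite \<sigma> \<and> sep_star \<sigma> \<and> finite (star_interior V \<sigma>))"

definition tangles :: "'a set \<Rightarrow> 'a set set \<Rightarrow> 'a osep set set" where
  "tangles V E = {\<tau>. aleph0_tangle V E \<tau>}"

definition comp_sep :: "'a set \<Rightarrow> 'a set \<Rightarrow> 'a set set \<Rightarrow> 'a osep" where
  "comp_sep V X \<C> = (V - \<Union>\<C>, X \<union> \<Union>\<C>)"

definition tangle_ultrafilter ::
    "'a set \<Rightarrow> 'a set set \<Rightarrow> 'a osep set \<Rightarrow> 'a set \<Rightarrow> 'a set set set" where
  "tangle_ultrafilter V E \<tau> X = {\<C>. \<C> \<subseteq> comps V E X \<and> comp_sep V X \<C> \<in> \<tau>}"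

text \<open>For an \<open>\<aleph>\<^sub>0\<close>-tangle \<open>\<tau>\<close> and finite \<open>X \<subseteq> V\<close>, the set \<open>tangle_ultrafilter V E \<tau> X\<close> is always an
  ultrafilter on \<open>comps V E X\<close>; such an ultrafilter is free iff its members have no common
  element.\<close>

definition ultrafilter_tangle :: "'a set \<Rightarrow> 'a set set \<Rightarrow> 'a osep set \<Rightarrow> bool" where
  "ultrafilter_tangle V E \<tau> \<longleftrightarrow>
     \<tau> \<in> tangles V E \<and> (\<exists>X\<subseteq>V. finite X \<and> \<Inter>(tangle_ultrafilter V E \<tau> X) = {})"

definition ultrafilter_tangles :: "'a set \<Rightarrow> 'a set set \<Rightarrow> 'a osep set set" where
  "ultrafilter_tangles V E = {\<tau>. ultrafilter_tangle V E \<tau>}"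


section \<open>The graph as a 1-complex\<close>

text \<open>Points of the 1-complex are given by barycentric coordinates \<open>p :: 'a \<Rightarrow> real\<close>. The point at
  parameter \<open>t \<in> [0,1]\<close> on the edge \<open>xy\<close>, traversed from \<open>x\<close> to \<open>y\<close>, has coordinate \<open>1 - t\<close> at \<open>x\<close>
  and \<open>t\<close> at \<open>y\<close>. Thus \<open>edge_point x y t = edge_point y x (1 - t)\<close>, and the end points are
  \<open>vertex_point x\<close> and \<open>vertex_point y\<close>.\<close>

definition vertex_point :: "'a \<Rightarrow> 'a \<Rightarrow> real" where
  "vertex_point v = (\<lambda>z. if z = v then 1 else 0)"

definition edge_point :: "'a \<Rightarrow> 'a \<Rightarrow> real \<Rightarrow> 'a \<Rightarrow> real" where
  "edge_point x y t = (\<lambda>z. if z = x then 1 - t else if z = y then t else 0)"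

text \<open>The points of the subgraph induced on \<open>W\<close>:\<close>

definition complex_points :: "'a set \<Rightarrow> 'a set set \<Rightarrow> ('a \<Rightarrow> real) set" where
  "complex_points W E = vertex_point ` W \<union>
     {edge_point x y t | x y t. x \<in> W \<and> y \<in> W \<and> {x, y} \<in> E \<and> 0 \<le> t \<and> t \<le> 1}"

text \<open>The union of the half-open intervals \<open>[v, i\<^sub>e)\<close> over the edges \<open>e = vw\<close> at \<open>v\<close>, where \<open>i\<^sub>e\<close> is
  the inner point of \<open>e\<close> at distance \<open>r w\<close> from \<open>v\<close>. The bounds \<open>r w\<close> may be chosen independently
  of each other, and need not be bounded away from \<open>0\<close>. The point of \<open>v\<close> is listed separately in
  case \<open>v\<close> has no incident edges.\<close>

definition open_star :: "'a set set \<Rightarrow> 'a \<Rightarrow> ('a \<Rightarrow> real) \<Rightarrow> ('a \<Rightarrow> real) set" where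
  "open_star E v r = insert (vertex_point v)
     {edge_point v w t | w t. {v, w} \<in> E \<and> 0 \<le> t \<and> t < r w}"

definition complex_topology :: "'a set \<Rightarrow> 'a set set \<Rightarrow> ('a \<Rightarrow> real) topology" where
  "complex_topology V E = topology_generated_by
     ({open_star E v r | v r. v \<in> V \<and> (\<forall>w. 0 < r w \<and> r w < 1)} \<union>
      {edge_point x y ` {a<..<b} | x y a b. {x, y} \<in> E \<and> 0 \<le> a \<and> a < b \<and> b \<le> 1})"

definition inner_edge_points :: "'a set set \<Rightarrow> 'a set \<Rightarrow> 'a set \<Rightarrow> ('a \<Rightarrow> real) set" where
  "inner_edge_points E X W =
     {edge_point x y t | x y t. x \<in> X \<and> y \<in> W \<and> {x, y} \<in> E \<and> 0 < t \<and> t < 1}"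


section \<open>The tangle compactification\<close>

type_synonym 'a tpoint = "('a \<Rightarrow> real) + 'a osep set"

definition basic_open :: "'a set \<Rightarrow> 'a set set \<Rightarrow> 'a set \<Rightarrow> 'a set set \<Rightarrow> 'a tpoint set" where
  "basic_open V E X \<C> =
     Inl ` ((\<Union>C\<in>\<C>. complex_points C E) \<union> inner_edge_points E X (\<Union>\<C>)) \<union>
     Inr ` {\<tau> \<in> tangles V E. comp_sep V X \<C> \<in> \<tau>}"

definition tangle_compactification :: "'a set \<Rightarrow> 'a set set \<Rightarrow> 'a tpoint topology" where
  "tangle_compactification V E = topology_generated_by
     ({Inl ` U | U. openin (complex_topology V E) U} \<union>
      {basic_open V E X \<C> | X \<C>. finite X \<and> X \<subseteq> V \<and> \<C> \<subseteq> comps V E X})"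

definition ultrafilter_tangle_space :: "'a set \<Rightarrow> 'a set set \<Rightarrow> 'a tpoint topology" where
  "ultrafilter_tangle_space V E =
     subtopology (tangle_compactification V E) (Inr ` ultrafilter_tangles V E)"


section \<open>Collectionwise normality\<close>

definition discrete_collection :: "'b topology \<Rightarrow> 'i set \<Rightarrow> ('i \<Rightarrow> 'b set) \<Rightarrow> bool" where
  "discrete_collection Y I A \<longleftrightarrow>
     (\<forall>i\<in>I. A i \<subseteq> topspace Y) \<and>
     (\<forall>y\<in>topspace Y. \<exists>U. openin Y U \<and> y \<in> U \<and>
        (\<forall>i\<in>I. \<forall>j\<in>I. A i \<inter> U \<noteq> {} \<and> A j \<inter> U \<noteq> {} \<longrightarrow> i = j))"

text \<open>Collections are indexed by themselves here, since a definition cannot quantify over index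
  types. As the members are pairwise disjoint, only repetitions of the empty set are lost.\<close>

definition collectionwise_normal :: "'b topology \<Rightarrow> bool" where
  "collectionwise_normal Y \<longleftrightarrow>
     (\<forall>y\<in>topspace Y. closedin Y {y}) \<and>
     (\<forall>\<A>. discrete_collection Y \<A> (\<lambda>A. A) \<and> disjoint_family_on (\<lambda>A. A) \<A> \<and>
          (\<forall>A\<in>\<A>. closedin Y A) \<longrightarrow>
        (\<exists>U. (\<forall>A\<in>\<A>. openin Y (U A) \<and> A \<subseteq> U A) \<and> disjoint_family_on U \<A>))"


section \<open>The underlying point sets\<close>

lemma topspace_complex_topology:
  assumes "simple_graph V E"
  shows "topspace (complex_topology V E) = complex_points V E"
proof -
  have ends: "x \<in> V" "y \<in> V" if "{x, y} \<in> E" for x y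
    using assms that unfolding simple_graph_def by (metis doubleton_eq_iff)+
  have sub: "open_star E v r \<subseteq> complex_points V E" if "v \<in> V" "\<And>w. 0 < r w \<and> r w < 1" for v r
  proof
    fix p assume "p \<in> open_star E v r"
    then consider "p = vertex_point v"
      | w t where "p = edge_point v w t" "{v, w} \<in> E" "0 \<le> t" "t < r w"
      unfolding open_star_def by blast
    then show "p \<in> complex_points V E"
    proof cases
      case 2
      then have "t \<le> 1" using that(2)[of w] by linarith
      then show ?thesis using 2 ends[of v w] unfolding complex_points_def by blast
    qed (use that in \<open>simp add: complex_points_def\<close>)
  qed
  have sub': "edge_point x y ` {a<..<b} \<subseteq> complex_points V E"
    if "{x, y} \<in> E" "0 \<le> a" "b \<le> 1" for x y a b
  proof
    fix p assume "p \<in> edge_point x y ` {a<..<b}"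
    then obtain t where "p = edge_point x y t" "a < t" "t < b" by auto
    moreover from this have "0 \<le> t" "t \<le> 1" using that by linarith+
    ultimately show "p \<in> complex_points V E"
      using that ends[of x y] unfolding complex_points_def by blast
  qed
  have star: "\<exists>r. vertex_point v \<in> open_star E v r \<and> (\<forall>w. 0 < r w \<and> r w < 1)" for v
    by (rule exI[of _ "\<lambda>_. 1/2"]) (simp add: open_star_def)
  have edge: "edge_point x y t \<in> vertex_point ` V \<or> edge_point x y t \<in> edge_point x y ` {0<..<1}"
    if "{x, y} \<in> E" "0 \<le> t" "t \<le> 1" for x y t
  proof -
    have "x \<noteq> y" using assms that unfolding simple_graph_def by (metis doubleton_eq_iff)
    then have "edge_point x y 0 = vertex_point x" "edge_point x y 1 = vertex_point y"
      by (auto simp: edge_point_def vertex_point_def)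
    then show ?thesis using that ends[of x y]
      by (cases "t = 0"; cases "t = 1") auto
  qed
  have v: "vertex_point v \<in> topspace (complex_topology V E)" if "v \<in> V" for v
  proof -
    obtain r where "vertex_point v \<in> open_star E v r" "\<forall>w. 0 < r w \<and> r w < 1"
      using star by blast
    then show ?thesis
      unfolding complex_topology_def topology_generated_by_topspace
      using that by (intro UnionI[of "open_star E v r"] UnI1) auto
  qed
  have e: "edge_point x y ` {0<..<1} \<subseteq> topspace (complex_topology V E)" if "{x, y} \<in> E" for x y
  proof -
    have "edge_point x y ` {0<..<1} \<in>
        {edge_point x y ` {a<..<b} | x y a b. {x, y} \<in> E \<and> 0 \<le> a \<and> a < b \<and> b \<le> 1}"
      using that zero_less_one by blast
    then show ?thesis
      unfolding complex_topology_def topology_generated_by_topspace by (intro Union_upper UnI2)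
  qed
  show ?thesis
  proof
    show "topspace (complex_topology V E) \<subseteq> complex_points V E"
      unfolding complex_topology_def topology_generated_by_topspace
    proof (rule Union_least, elim UnE)
      fix S assume "S \<in> {open_star E v r | v r. v \<in> V \<and> (\<forall>w. 0 < r w \<and> r w < 1)}"
      then obtain v r where "S = open_star E v r" "v \<in> V" "\<forall>w. 0 < r w \<and> r w < 1" by auto
      then show "S \<subseteq> complex_points V E" using sub[of v r] by simp
    next
      fix S assume "S \<in> {edge_point x y ` {a<..<b} | x y a b.
          {x, y} \<in> E \<and> 0 \<le> a \<and> a < b \<and> b \<le> 1}"
      then obtain x y a b where "S = edge_point x y ` {a<..<b}" "{x, y} \<in> E" "0 \<le> a" "b \<le> 1"
        by auto
      then show "S \<subseteq> complex_points V E" using sub'[of x y a b] by simp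
    qed
    show "complex_points V E \<subseteq> topspace (complex_topology V E)"
    proof
      fix p assume "p \<in> complex_points V E"
      then consider v where "v \<in> V" "p = vertex_point v"
        | x y t where "{x, y} \<in> E" "0 \<le> t" "t \<le> 1" "p = edge_point x y t"
        unfolding complex_points_def by blast
      then show "p \<in> topspace (complex_topology V E)"
      proof cases
        case 1
        then show ?thesis using v by simp
      next
        case (2 x y t)
        from edge[OF 2(1-3)] show ?thesis
        proof
          assume "edge_point x y t \<in> vertex_point ` V"
          then show ?thesis using v 2(4) by auto
        next
          assume "edge_point x y t \<in> edge_point x y ` {0<..<1}"
          then show ?thesis using e[OF 2(1)] 2(4) by (metis subsetD)
        qed
      qed
    qed
  qed
qed

lemma topspace_tangle_compactification:
  assumes "simple_graph V E"
  shows "topspace (tangle_compactification V E) = complex_points V E <+> tangles V E"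
proof -
  have ends: "x \<in> V" "y \<in> V" if "{x, y} \<in> E" for x y
    using assms that unfolding simple_graph_def by (metis doubleton_eq_iff)+
  have U: "\<Union>(comps V E X) = V - X" for X
    unfolding comps_def path_rel_def quotient_def by auto
  have sub: "basic_open V E X \<C> \<subseteq> complex_points V E <+> tangles V E"
    if "X \<subseteq> V" "\<C> \<subseteq> comps V E X" for X \<C>
  proof -
    have "\<Union>\<C> \<subseteq> V" using that U[of X] by blast
    then have "(\<Union>C\<in>\<C>. complex_points C E) \<subseteq> complex_points V E"
      unfolding complex_points_def by blast
    moreover have "inner_edge_points E X (\<Union>\<C>) \<subseteq> complex_points V E"
    proof
      fix p assume "p \<in> inner_edge_points E X (\<Union>\<C>)"
      then obtain x y t where "p = edge_point x y t" "{x, y} \<in> E" "0 \<le> t" "t \<le> 1"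
        unfolding inner_edge_points_def by (auto intro: less_imp_le)
      then show "p \<in> complex_points V E"
        using ends[of x y] unfolding complex_points_def by blast
    qed
    ultimately show ?thesis unfolding basic_open_def by blast
  qed
  have all: "Inr \<tau> \<in> basic_open V E {} (comps V E {})" if "\<tau> \<in> tangles V E" for \<tau>
  proof -
    have t: "aleph0_tangle V E \<tau>" using that by (simp add: tangles_def)
    have "{{}, V} \<in> finite_order_seps V E" unfolding finite_order_seps_def by auto
    then obtain r where r: "r \<in> \<tau>" "unoriented r = {{}, V}"
      using t unfolding aleph0_tangle_def orientation_of_def by metis
    then have "r = ({}, V) \<or> r = (V, {})"
      by (cases r) (auto simp: unoriented_def doubleton_eq_iff)
    moreover have "(V, {}) \<notin> \<tau>"
    proof
      assume "(V, {}) \<in> \<tau>"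
      then have "{(V, {})} \<subseteq> \<tau>" "finite {(V, {} :: 'a set)}" "sep_star {(V, {})}"
        "finite (star_interior V {(V, {})})"
        by (auto simp: sep_star_def star_interior_def)
      then show False using t unfolding aleph0_tangle_def by blast
    qed
    ultimately have "({}, V) \<in> \<tau>" using r by auto
    then show ?thesis using that U[of "{}"] by (simp add: basic_open_def comp_sep_def)
  qed
  have c: "topspace (tangle_compactification V E) =
      Inl ` complex_points V E \<union>
      \<Union>{basic_open V E X \<C> | X \<C>. finite X \<and> X \<subseteq> V \<and> \<C> \<subseteq> comps V E X}"
  proof -
    have "\<Union>{Inl ` W :: 'a tpoint set | W. openin (complex_topology V E) W} =
        Inl ` complex_points V E"
      unfolding topspace_complex_topology[OF assms, symmetric]
      using openin_subset openin_topspace by blast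
    then show ?thesis
      unfolding tangle_compactification_def topology_generated_by_topspace Union_Un_distrib by simp
  qed
  show ?thesis
  proof
    show "topspace (tangle_compactification V E) \<subseteq> complex_points V E <+> tangles V E"
      unfolding c using sub by blast
    have "Inr \<tau> \<in> topspace (tangle_compactification V E)" if "\<tau> \<in> tangles V E" for \<tau>
      unfolding c using all[OF that] by blast
    then show "complex_points V E <+> tangles V E \<subseteq> topspace (tangle_compactification V E)"
      unfolding Plus_def c by blast
  qed
qed

end

theory Submission
  imports Defs
begin

text \<open>An ultrafilter tangle \<open>\<tau>\<close> is located at some finite \<open>X\<close>: the ultrafilter of \<open>\<tau>\<close> at \<open>X\<close> is
  free and contains the set of components of \<open>G - X\<close> whose neighbourhood is all of \<open>X\<close>. The sets
  \<open>\<O>(X, \<C>)\<close> with \<open>\<C>\<close> in this ultrafilter form a neighbourhood base of \<open>\<tau>\<close>. Since the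
  tangles located at \<open>X\<close> form a compact space, only finitely many members of a discrete collection
  contain one of them, and the full components at \<open>X\<close> can be divided up, apart from finitely many,
  into classes \<open>\<K> X i\<close> such that \<open>\<O>(X, \<K> X i)\<close> misses \<open>A j\<close> for all \<open>j \<noteq> i\<close>. Let \<open>U i\<close> be the
  union of \<open>\<O>(X, \<K> X i)\<close> over those \<open>X\<close> at which some element of \<open>A i\<close> is located. These sets are
  disjoint without any shrinking: if a component \<open>C \<in> \<K> X i\<close> met \<open>Y\<close>, then \<open>C\<close> would contain almost
  all full components at \<open>Y\<close>, so every tangle located at \<open>Y\<close> would lie in \<open>\<O>(X, \<K> X i)\<close>, which is
  impossible if \<open>A j\<close> with \<open>j \<noteq> i\<close> contains one of them.\<close>


section \<open>Prime ideals\<close>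

text \<open>The ultrafilter lemma in dual form: Zorn's lemma gives a maximal ideal that contains
  \<open>J\<close> and omits \<open>M\<close>. Ideals are the convenient form because the colourable
  sets of components will form one.\<close>

lemma prime_ideal_exists:
  assumes "J \<subseteq> Pow M" "M \<notin> J" "J \<noteq> {}"
    and "\<And>S T. S \<in> J \<Longrightarrow> T \<in> J \<Longrightarrow> S \<union> T \<in> J"
    and "\<And>S T. S \<in> J \<Longrightarrow> T \<subseteq> S \<Longrightarrow> T \<in> J"
  obtains K where "J \<subseteq> K" "K \<subseteq> Pow M" "M \<notin> K"
    and "\<forall>S\<in>K. \<forall>T\<in>K. S \<union> T \<in> K" "\<forall>S\<in>K. \<forall>T\<subseteq>S. T \<in> K"
    and "\<forall>S\<subseteq>M. S \<in> K \<or> M - S \<in> K"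
proof -
  define ideals where "ideals = {K. J \<subseteq> K \<and> K \<subseteq> Pow M \<and> M \<notin> K \<and>
      (\<forall>S\<in>K. \<forall>T\<in>K. S \<union> T \<in> K) \<and> (\<forall>S\<in>K. \<forall>T. T \<subseteq> S \<longrightarrow> T \<in> K)}"
  have J: "J \<in> ideals"
    using assms unfolding ideals_def by blast
  have chains: "\<Union>c \<in> ideals" if c: "c \<noteq> {}" "subset.chain ideals c" for c
  proof -
    have sub: "\<And>K. K \<in> c \<Longrightarrow> K \<in> ideals"
      and comparable: "\<And>K L. K \<in> c \<Longrightarrow> L \<in> c \<Longrightarrow> K \<subseteq> L \<or> L \<subseteq> K"
      using c(2) unfolding subset.chain_def by auto
    have ideal: "J \<subseteq> K" "K \<subseteq> Pow M" "M \<notin> K" "\<forall>S\<in>K. \<forall>T\<in>K. S \<union> T \<in> K"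
      "\<forall>S\<in>K. \<forall>T. T \<subseteq> S \<longrightarrow> T \<in> K" if "K \<in> c" for K
      using sub[OF that] unfolding ideals_def by simp_all
    have "S \<union> T \<in> \<Union>c" if ST: "S \<in> \<Union>c" "T \<in> \<Union>c" for S T
    proof -
      obtain K L where "K \<in> c" "L \<in> c" "S \<in> K" "T \<in> L"
        using ST by blast
      then obtain N where "N \<in> c" "S \<in> N" "T \<in> N"
        using comparable[of K L] by blast
      then show ?thesis
        using ideal(4) by blast
    qed
    moreover have "J \<subseteq> \<Union>c"
      using c(1) ideal(1) by (meson Union_upper ex_in_conv subset_trans)
    moreover have "\<Union>c \<subseteq> Pow M"
      using ideal(2) by (rule Union_least)
    moreover have "M \<notin> \<Union>c"
      using ideal(3) by (meson UnionE)
    moreover have "T \<in> \<Union>c" if "S \<in> \<Union>c" "T \<subseteq> S" for S T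
      using ideal(5) that by (meson UnionE UnionI)
    ultimately show ?thesis
      unfolding ideals_def by simp
  qed
  obtain K where K: "K \<in> ideals" and max: "\<And>L. L \<in> ideals \<Longrightarrow> K \<subseteq> L \<Longrightarrow> L = K"
    using subset_Zorn_nonempty[of ideals] J chains by blast
  have JK: "J \<subseteq> K" and KM: "K \<subseteq> Pow M" "M \<notin> K"
    and all_un: "\<forall>S\<in>K. \<forall>T\<in>K. S \<union> T \<in> K"
    and all_down: "\<forall>S\<in>K. \<forall>T. T \<subseteq> S \<longrightarrow> T \<in> K"
    using K unfolding ideals_def by simp_all
  have down: "T \<in> K" if "S \<in> K" "T \<subseteq> S" for S T
    using all_down that by blast
  have prime: "S \<in> K \<or> M - S \<in> K" if S: "S \<subseteq> M" for S
  proof (rule disjCI)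
    assume n: "M - S \<notin> K"
    \<comment> \<open>\<open>L\<close> is the ideal generated by \<open>K\<close> and
      \<open>S\<close>. As \<open>M - S \<notin> K\<close>, it still omits \<open>M\<close>, so
      maximality of \<open>K\<close> gives \<open>L = K\<close>.\<close>
    define L where "L = {T. T \<subseteq> M \<and> T - S \<in> K}"
    have "K \<subseteq> L"
      using KM down unfolding L_def by blast
    moreover have "T \<union> T' \<in> L" if "T \<in> L" "T' \<in> L" for T T'
      using all_un that unfolding L_def by (auto simp: Un_Diff)
    moreover have "T' \<in> L" if "T \<in> L" "T' \<subseteq> T" for T T'
      using down[of "T - S" "T' - S"] that unfolding L_def by blast
    moreover have "L \<subseteq> Pow M" "M \<notin> L"
      using n unfolding L_def by auto
    moreover have "J \<subseteq> L"
      using JK \<open>K \<subseteq> L\<close> by (rule subset_trans)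
    ultimately have "L \<in> ideals"
      unfolding ideals_def by simp
    then have "L = K"
      using max \<open>K \<subseteq> L\<close> by blast
    moreover have "{} \<in> K"
      using JK assms(3) down by blast
    then have "S \<in> L"
      using S unfolding L_def by simp
    ultimately show "S \<in> K" by simp
  qed
  show thesis
    using that[OF JK KM all_un all_down] prime by blast
qed


section \<open>Components\<close>

locale graph =
  fixes V :: "'a set" and E :: "'a set set"
  assumes simple: "simple_graph V E"
begin

lemma equiv_path_rel: "equiv W (path_rel W E)"
proof -
  let ?r = "{(x, y). x \<in> W \<and> y \<in> W \<and> {x, y} \<in> E}"
  have "sym ?r"
    by (auto simp: sym_def insert_commute)
  then have "sym (?r\<^sup>*)"
    by (rule sym_rtrancl)
  then show ?thesis
    unfolding path_rel_def equiv_def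
    by (auto simp: refl_on_def sym_def intro!: transI)
qed

lemma comps_disjoint: "C \<in> comps V E X \<Longrightarrow> D \<in> comps V E X \<Longrightarrow> x \<in> C \<Longrightarrow> x \<in> D \<Longrightarrow> C = D"
  unfolding comps_def using quotient_disj[OF equiv_path_rel] by blast

lemma comps_nonempty: "C \<in> comps V E X \<Longrightarrow> C \<noteq> {}"
  unfolding comps_def by (rule in_quotient_imp_non_empty[OF equiv_path_rel])

lemma Union_comps: "\<Union>(comps V E X) = V - X"
  unfolding comps_def by (rule Union_quotient[OF equiv_path_rel])

lemma comps_subset: "C \<in> comps V E X \<Longrightarrow> C \<subseteq> V - X"
  using Union_comps by blast

lemma comps_edge_closed:
  assumes "C \<in> comps V E X" "a \<in> C" "{a, b} \<in> E" "b \<in> V" "b \<notin> X"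
  shows "b \<in> C"
proof -
  have "a \<in> V - X" using comps_subset assms(1,2) by blast
  then have "(a, b) \<in> path_rel (V - X) E"
    using assms unfolding path_rel_def by auto
  then show ?thesis
    using in_quotient_imp_closed[OF equiv_path_rel] assms(1,2) unfolding comps_def by blast
qed

text \<open>Connectedness as an induction principle: a path from \<open>a\<close> to a vertex of
  \<open>C\<close> never leaves \<open>C\<close>, hence by closedness never leaves
  \<open>S\<close>.\<close>

lemma comps_connected:
  assumes C: "C \<in> comps V E X" and a: "a \<in> C" "a \<in> S"
    and closed: "\<And>x y. x \<in> C \<Longrightarrow> x \<in> S \<Longrightarrow> y \<in> C \<Longrightarrow> {x, y} \<in> E \<Longrightarrow> y \<in> S"
  shows "C \<subseteq> S"
proof
  fix b assume "b \<in> C"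
  then have "(a, b) \<in> path_rel (V - X) E"
    using in_quotient_imp_in_rel[OF equiv_path_rel] C a unfolding comps_def by blast
  then have "(a, b) \<in> {(x, y). x \<in> V - X \<and> y \<in> V - X \<and> {x, y} \<in> E}\<^sup>*"
    unfolding path_rel_def by blast
  then have "b \<in> C \<and> b \<in> S"
  proof induction
    case base
    then show ?case using a by blast
  next
    case (step y z)
    then have "z \<in> C" using comps_edge_closed[OF C, of y z] by blast
    then show ?case using closed step by blast
  qed
  then show "b \<in> S" by blast
qed

text \<open>\<open>C\<close> stays connected in \<open>G - Y\<close>, so it lies inside a single
  component there.\<close>

lemma comps_refine:
  assumes "C \<in> comps V E X" "C \<inter> Y = {}"
  obtains D where "D \<in> comps V E Y" "C \<subseteq> D"
proof -
  obtain a where a: "a \<in> C" using comps_nonempty assms(1) by blast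
  then have "a \<in> V - Y" using comps_subset assms by blast
  then obtain D where D: "D \<in> comps V E Y" "a \<in> D"
    using Union_comps by blast
  have "C \<subseteq> D"
  proof (rule comps_connected[OF assms(1) a D(2)])
    fix x y assume "x \<in> C" "x \<in> D" "y \<in> C" "{x, y} \<in> E"
    then show "y \<in> D"
      using comps_edge_closed[OF D(1)] comps_subset[OF assms(1)] assms(2) by blast
  qed
  then show thesis using that D(1) by blast
qed

lemma comps_meet_subset:
  assumes "C \<in> comps V E X" "C \<inter> Y = {}" "D \<in> comps V E Y" "C \<inter> D \<noteq> {}"
  shows "C \<subseteq> D"
proof -
  obtain D' where D': "D' \<in> comps V E Y" "C \<subseteq> D'" using comps_refine[OF assms(1,2)] .
  obtain x where "x \<in> C" "x \<in> D" using assms(4) by blast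
  then have "D' = D" using comps_disjoint[OF D'(1) assms(3)] D'(2) by blast
  then show ?thesis using D'(2) by blast
qed

text \<open>Components are disjoint, so each vertex of \<open>Y\<close> lies in at most one of
  them.\<close>

lemma finite_comps_meeting:
  assumes "finite Y"
  shows "finite {C \<in> comps V E X. C \<inter> Y \<noteq> {}}"
proof -
  let ?f = "\<lambda>y. THE C. C \<in> comps V E X \<and> y \<in> C"
  have "{C \<in> comps V E X. C \<inter> Y \<noteq> {}} \<subseteq> ?f ` Y"
  proof
    fix C assume "C \<in> {C \<in> comps V E X. C \<inter> Y \<noteq> {}}"
    then obtain y where y: "y \<in> Y" "C \<in> comps V E X" "y \<in> C" by blast
    then have "?f y = C"
      using comps_disjoint by (intro the_equality) blast+
    then show "C \<in> ?f ` Y" using y(1) by blast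
  qed
  then show ?thesis using assms finite_subset by blast
qed

section \<open>Full components\<close>

text \<open>The neighbourhood of a component of \<open>G - X\<close> always lies in
  \<open>X\<close>; here it is all of \<open>X\<close>. A finite \<open>X\<close> with infinitely
  many full components is known as a critical vertex set.\<close>

definition full_comps :: "'a set \<Rightarrow> 'a set set" where
  "full_comps X = {C \<in> comps V E X. \<forall>x\<in>X. \<exists>y\<in>C. {x, y} \<in> E}"

lemma full_comps_subset: "full_comps X \<subseteq> comps V E X"
  unfolding full_comps_def by blast

text \<open>If they met, each would contain the other, and the common component would have both
  \<open>X\<close> and \<open>Y\<close> as its neighbourhood.\<close>

lemma full_comps_disjoint:
  assumes C: "C \<in> full_comps X" "C \<inter> Y = {}" and D: "D \<in> full_comps Y" "D \<inter> X = {}"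
    and "X \<subseteq> V" "Y \<subseteq> V" "X \<noteq> Y"
  shows "C \<inter> D = {}"
proof (rule ccontr)
  assume meet: "C \<inter> D \<noteq> {}"
  have c: "C \<in> comps V E X" and d: "D \<in> comps V E Y"
    using C D full_comps_subset by blast+
  then have eq: "C = D"
    using comps_meet_subset[OF c C(2) d] comps_meet_subset[OF d D(2) c] meet by blast
  have X: "X \<subseteq> Y"
  proof
    fix x assume x: "x \<in> X"
    then obtain y where "y \<in> D" "{y, x} \<in> E"
      using C(1) eq unfolding full_comps_def by (auto simp: insert_commute)
    then show "x \<in> Y"
      using comps_edge_closed[OF d] x D(2) assms(5) by blast
  qed
  have "Y \<subseteq> X"
  proof
    fix x assume x: "x \<in> Y"
    then obtain y where "y \<in> C" "{y, x} \<in> E"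
      using D(1) eq unfolding full_comps_def by (auto simp: insert_commute)
    then show "x \<in> X"
      using comps_edge_closed[OF c] x C(2) assms(6) by blast
  qed
  then show False using X assms(7) by blast
qed

text \<open>Vertices of \<open>X - Z\<close> have no neighbour in \<open>C\<close>, so putting them
  back into the graph does not enlarge \<open>C\<close>.\<close>

lemma comps_shrink:
  assumes C: "C \<in> comps V E X" and "Z \<subseteq> X" and none: "\<And>x y. x \<in> X - Z \<Longrightarrow> y \<in> C \<Longrightarrow> {x, y} \<notin> E"
  shows "C \<in> comps V E Z"
proof -
  have "C \<inter> Z = {}" using comps_subset[OF C] assms(2) by blast
  then obtain D where D: "D \<in> comps V E Z" "C \<subseteq> D"
    using comps_refine C by blast
  obtain a where a: "a \<in> C" using comps_nonempty C by blast
  have "D \<subseteq> C"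
  proof (rule comps_connected[OF D(1) _ a])
    show "a \<in> D" using a D by blast
    fix x y assume xy: "x \<in> D" "x \<in> C" "y \<in> D" "{x, y} \<in> E"
    have y: "y \<in> V" "y \<notin> Z" using comps_subset[OF D(1)] xy by blast+
    have "y \<notin> X" using none[of y x] xy y by (auto simp: insert_commute)
    then show "y \<in> C" using comps_edge_closed[OF C] xy y by blast
  qed
  then have "D = C" using D(2) by blast
  then show ?thesis using D(1) by simp
qed


section \<open>Tangles as ultrafilters\<close>

text \<open>The condition of \<open>finite_order_seps\<close> on an ordered pair, so that the two
  sides can be told apart.\<close>

definition fin_sep :: "'a set \<Rightarrow> 'a set \<Rightarrow> bool" where
  "fin_sep A B \<longleftrightarrow> A \<union> B = V \<and> finite (A \<inter> B) \<and> (\<forall>a\<in>A - B. \<forall>b\<in>B - A. {a, b} \<notin> E)"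

lemma fin_sep_swap: "fin_sep A B \<longleftrightarrow> fin_sep B A"
proof -
  have "fin_sep D C" if "fin_sep C D" for C D
    using that unfolding fin_sep_def by (metis Un_commute Int_commute insert_commute)
  then show ?thesis by blast
qed

lemma finite_order_seps_iff: "{A, B} \<in> finite_order_seps V E \<longleftrightarrow> fin_sep A B"
proof
  assume "{A, B} \<in> finite_order_seps V E"
  then obtain C D where "{A, B} = {C, D}" "fin_sep C D"
    unfolding finite_order_seps_def fin_sep_def by blast
  then show "fin_sep A B"
    using fin_sep_swap by (auto simp: doubleton_eq_iff)
qed (auto simp: finite_order_seps_def fin_sep_def)

text \<open>The new separator lies in the union of the old two, and an edge crossing the corner
  separation would cross one of the given ones.\<close>

lemma fin_sep_corner: "fin_sep A B \<Longrightarrow> fin_sep C D \<Longrightarrow> fin_sep (A \<union> C) (B \<inter> D)"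
proof -
  assume s: "fin_sep A B" "fin_sep C D"
  have "(A \<union> C) \<inter> (B \<inter> D) \<subseteq> (A \<inter> B) \<union> (C \<inter> D)" by blast
  moreover have "finite ((A \<inter> B) \<union> (C \<inter> D))" using s unfolding fin_sep_def by simp
  ultimately have "finite ((A \<union> C) \<inter> (B \<inter> D))" by (rule finite_subset)
  moreover have "{a, b} \<notin> E" if "a \<in> (A \<union> C) - (B \<inter> D)" "b \<in> (B \<inter> D) - (A \<union> C)" for a b
  proof -
    have "a \<in> A - B \<or> a \<in> C - D" using s that unfolding fin_sep_def by blast
    then show ?thesis using s that unfolding fin_sep_def by blast
  qed
  ultimately show ?thesis using s unfolding fin_sep_def by blast
qed

lemma fin_sep_comp_sep:
  assumes "finite X" "X \<subseteq> V" "\<C> \<subseteq> comps V E X"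
  shows "fin_sep (V - \<Union>\<C>) (X \<union> \<Union>\<C>)"
proof -
  have sub: "\<Union>\<C> \<subseteq> V - X" using assms(3) Union_comps by blast
  have "(V - \<Union>\<C>) \<inter> (X \<union> \<Union>\<C>) \<subseteq> X" by blast
  then have "finite ((V - \<Union>\<C>) \<inter> (X \<union> \<Union>\<C>))" by (rule finite_subset) (rule assms(1))
  moreover have "{a, b} \<notin> E"
    if a: "a \<in> (V - \<Union>\<C>) - (X \<union> \<Union>\<C>)" and b: "b \<in> (X \<union> \<Union>\<C>) - (V - \<Union>\<C>)" for a b
  proof
    assume "{a, b} \<in> E"
    moreover obtain C where "C \<in> \<C>" "b \<in> C" using b assms(2) by blast
    ultimately show False
      using comps_edge_closed[of C X b a] a assms(3) by (auto simp: insert_commute)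
  qed
  ultimately show ?thesis
    unfolding fin_sep_def using sub assms(2) by blast
qed

text \<open>A component of \<open>G - (A \<inter> B)\<close> cannot have vertices on both sides, so
  \<open>B - A\<close> is a union of components. Thus every finite-order separation has the form
  \<open>(X, \<C>)\<close>.\<close>

lemma comp_sep_cases:
  assumes "fin_sep A B"
  shows "comp_sep V (A \<inter> B) {C \<in> comps V E (A \<inter> B). C \<subseteq> B} = (A, B)"
proof -
  let ?X = "A \<inter> B"
  have side: "C \<subseteq> B - A" if C: "C \<in> comps V E ?X" "b \<in> C" "b \<in> B" for C b
  proof (rule comps_connected[OF C(1,2)])
    show "b \<in> B - A" using C comps_subset by blast
    fix x y assume xy: "x \<in> C" "x \<in> B - A" "y \<in> C" "{x, y} \<in> E"
    then have "y \<in> V" "y \<notin> A \<inter> B" using C(1) comps_subset by blast+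
    moreover have "y \<notin> A - B"
      using xy assms insert_commute[of x y "{}"] unfolding fin_sep_def by auto
    ultimately show "y \<in> B - A"
      using assms unfolding fin_sep_def by blast
  qed
  have "\<Union>{C \<in> comps V E ?X. C \<subseteq> B} = B - A"
  proof
    show "\<Union>{C \<in> comps V E ?X. C \<subseteq> B} \<subseteq> B - A"
      using comps_subset by blast
    show "B - A \<subseteq> \<Union>{C \<in> comps V E ?X. C \<subseteq> B}"
    proof
      fix b assume b: "b \<in> B - A"
      then have "b \<in> V - ?X" using assms unfolding fin_sep_def by blast
      then obtain C where "C \<in> comps V E ?X" "b \<in> C" using Union_comps by blast
      then show "b \<in> \<Union>{C \<in> comps V E ?X. C \<subseteq> B}"
        using side b by blast
    qed
  qed
  then show ?thesis
    using assms unfolding comp_sep_def fin_sep_def by auto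
qed

section \<open>Closure properties of a single tangle\<close>

context
  fixes \<tau> assumes \<tau>: "\<tau> \<in> tangles V E"
begin

lemma tangle_orient: "fin_sep A B \<Longrightarrow> (A, B) \<in> \<tau> \<or> (B, A) \<in> \<tau>"
proof -
  assume "fin_sep A B"
  then have s: "{A, B} \<in> finite_order_seps V E" by (simp add: finite_order_seps_iff)
  have "orientation_of (finite_order_seps V E) \<tau>"
    using \<tau> unfolding tangles_def aleph0_tangle_def by simp
  then have "\<exists>!r. r \<in> \<tau> \<and> unoriented r = {A, B}"
    unfolding orientation_of_def using s by simp
  then obtain r where r: "r \<in> \<tau>" "unoriented r = {A, B}" by blast
  then have "r = (A, B) \<or> r = (B, A)"
    by (cases r) (auto simp: unoriented_def doubleton_eq_iff)
  then show ?thesis using r(1) by blast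
qed

lemma tangle_fin_sep: "(A, B) \<in> \<tau> \<Longrightarrow> fin_sep A B"
proof -
  assume "(A, B) \<in> \<tau>"
  then have "unoriented (A, B) \<in> finite_order_seps V E"
    using \<tau> unfolding tangles_def aleph0_tangle_def orientation_of_def by blast
  then show ?thesis
    by (simp add: unoriented_def finite_order_seps_iff)
qed

lemma tangle_star:
  assumes "\<sigma> \<subseteq> \<tau>" "finite \<sigma>" "sep_star \<sigma>"
  shows "infinite (star_interior V \<sigma>)"
  using \<tau> assms unfolding tangles_def aleph0_tangle_def by blast

text \<open>A single separation is a star with interior \<open>B\<close>.\<close>

lemma tangle_infinite: "(A, B) \<in> \<tau> \<Longrightarrow> infinite B"
  using tangle_star[of "{(A, B)}"] by (auto simp: sep_star_def star_interior_def)

lemma tangle_consistent: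
  assumes "(C, D) \<in> \<tau>" "fin_sep A B" "A \<subseteq> C" "D \<subseteq> B"
  shows "(A, B) \<in> \<tau>"
proof (rule ccontr)
  assume n: "(A, B) \<notin> \<tau>"
  then have BA: "(B, A) \<in> \<tau>" using tangle_orient assms(2) by blast
  have "sep_less (A, B) (C, D)"
    using n assms unfolding sep_less_def sep_le_def by auto
  moreover have "prod.swap (A, B) \<in> \<tau>" using BA by simp
  ultimately have "unoriented (A, B) = unoriented (C, D)"
    using \<tau> assms(1) unfolding tangles_def aleph0_tangle_def consistent_def by blast
  \<comment> \<open>\<open>consistent\<close> compares only distinct unoriented separations. In the
    remaining case the two pairs are inverse to each other, and then \<open>D\<close> is contained
    in the finite separator.\<close>
  then have "A = D" "B = C"
    using n assms(1) by (auto simp: unoriented_def doubleton_eq_iff)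
  then have "D = C \<inter> D" using assms(3) by blast
  then show False
    using tangle_infinite[OF assms(1)] tangle_fin_sep[OF assms(1)] unfolding fin_sep_def by metis
qed

text \<open>If \<open>(A, B)\<close> and \<open>(C, D)\<close> lie in the tangle but \<open>(A \<union> C, B \<inter> D)\<close> does not, then uncrossing
  yields a star of three members of the tangle with finite interior.\<close>

lemma tangle_inter:
  assumes AB: "(A, B) \<in> \<tau>" and CD: "(C, D) \<in> \<tau>"
  shows "(A \<union> C, B \<inter> D) \<in> \<tau>"
proof (rule ccontr)
  assume n: "(A \<union> C, B \<inter> D) \<notin> \<tau>"
  have sAB: "fin_sep A B" and sCD: "fin_sep C D"
    using tangle_fin_sep AB CD by blast+
  have t: "(B \<inter> D, A \<union> C) \<in> \<tau>"
    using tangle_orient[OF fin_sep_corner[OF sAB sCD]] n by blast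
  have "fin_sep (D \<union> A) (C \<inter> B)"
    using fin_sep_corner[of D C A B] sAB sCD fin_sep_swap by blast
  then have s: "(C \<inter> B, D \<union> A) \<in> \<tau>"
    using tangle_consistent[OF CD] fin_sep_swap by blast
  \<comment> \<open>Replacing \<open>(C, D)\<close> by the smaller
    \<open>(C \<inter> B, D \<union> A)\<close> makes the three separations nested. A vertex of the
    interior lies in \<open>A \<inter> B\<close> if it is in \<open>A\<close>, and in
    \<open>C \<inter> D\<close> otherwise.\<close>
  let ?\<sigma> = "{(A, B), (C \<inter> B, D \<union> A), (B \<inter> D, A \<union> C)}"
  have "sep_star ?\<sigma>"
    unfolding sep_star_def sep_le_def by auto
  then have "infinite (star_interior V ?\<sigma>)"
    using tangle_star[of ?\<sigma>] AB s t by blast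
  moreover have "star_interior V ?\<sigma> \<subseteq> (A \<inter> B) \<union> (C \<inter> D)"
    unfolding star_interior_def by auto
  moreover have "finite ((A \<inter> B) \<union> (C \<inter> D))"
    using sAB sCD unfolding fin_sep_def by blast
  ultimately show False by (metis finite_subset)
qed

lemma tangle_inter_infinite: "(A, B) \<in> \<tau> \<Longrightarrow> (C, D) \<in> \<tau> \<Longrightarrow> infinite (B \<inter> D)"
  using tangle_inter tangle_infinite by blast

text \<open>Otherwise \<open>(D, C)\<close> is in the tangle, and then \<open>C \<inter> B\<close>
  is infinite. This reduces most membership proofs to a finiteness check.\<close>

lemma tangle_mono:
  assumes "(A, B) \<in> \<tau>" "fin_sep C D" "finite (C \<inter> B)"
  shows "(C, D) \<in> \<tau>"
  using tangle_orient[OF assms(2)] tangle_inter_infinite[OF assms(1), of D C] assms(3)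
  by (auto simp: Int_commute)

section \<open>The ultrafilter of a tangle on the components of \<open>G - X\<close>\<close>

abbreviation (input) "\<U> X \<equiv> tangle_ultrafilter V E \<tau> X"

context
  fixes X assumes X: "finite X" "X \<subseteq> V"
begin

lemma ultra_subset: "\<C> \<in> \<U> X \<Longrightarrow> \<C> \<subseteq> comps V E X"
  unfolding tangle_ultrafilter_def by blast

lemma ultra_mono:
  assumes "\<C> \<in> \<U> X" "\<C> \<subseteq> \<D>" "\<D> \<subseteq> comps V E X"
  shows "\<D> \<in> \<U> X"
proof -
  have "finite ((V - \<Union>\<D>) \<inter> (X \<union> \<Union>\<C>))"
    using X(1) assms(2) by (auto intro: finite_subset[of _ X])
  then show ?thesis
    using assms tangle_mono fin_sep_comp_sep[OF X assms(3)]
    unfolding tangle_ultrafilter_def comp_sep_def by blast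
qed

lemma ultra_inter:
  assumes "\<C> \<in> \<U> X" "\<D> \<in> \<U> X"
  shows "\<C> \<inter> \<D> \<in> \<U> X"
proof -
  have sub: "\<C> \<subseteq> comps V E X" "\<D> \<subseteq> comps V E X"
    using assms unfolding tangle_ultrafilter_def by blast+
  \<comment> \<open>Disjointness of components lets the union commute with the intersection, so the
    separation supplied by \<open>tangle_inter\<close> is again a \<open>comp_sep\<close> at
    \<open>X\<close>.\<close>
  have eq: "\<Union>(\<C> \<inter> \<D>) = \<Union>\<C> \<inter> \<Union>\<D>"
    using comps_disjoint sub by blast
  have "comp_sep V X (\<C> \<inter> \<D>) = ((V - \<Union>\<C>) \<union> (V - \<Union>\<D>), (X \<union> \<Union>\<C>) \<inter> (X \<union> \<Union>\<D>))"
    unfolding comp_sep_def eq by auto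
  then show ?thesis
    using assms tangle_inter sub unfolding tangle_ultrafilter_def comp_sep_def by auto
qed

lemma ultra_nonempty: "{} \<notin> \<U> X"
  using tangle_infinite X unfolding tangle_ultrafilter_def comp_sep_def by auto

lemma ultra_compl:
  assumes "\<C> \<subseteq> comps V E X" "\<C> \<notin> \<U> X"
  shows "comps V E X - \<C> \<in> \<U> X"
proof -
  let ?D = "comps V E X - \<C>"
  have "(X \<union> \<Union>\<C>, V - \<Union>\<C>) \<in> \<tau>"
    using assms tangle_orient[OF fin_sep_comp_sep[OF X assms(1)]]
    unfolding tangle_ultrafilter_def comp_sep_def by blast
  moreover have "(V - \<Union>?D) \<inter> (V - \<Union>\<C>) \<subseteq> X"
    using Union_comps[of X] by blast
  then have "finite ((V - \<Union>?D) \<inter> (V - \<Union>\<C>))"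
    by (rule finite_subset) (rule X(1))
  ultimately have "(V - \<Union>?D, X \<union> \<Union>?D) \<in> \<tau>"
    using tangle_mono fin_sep_comp_sep[OF X, of ?D] by blast
  then show ?thesis
    unfolding tangle_ultrafilter_def comp_sep_def by blast
qed

lemma ultra_un:
  assumes "\<C> \<union> \<D> \<in> \<U> X"
  shows "\<C> \<in> \<U> X \<or> \<D> \<in> \<U> X"
proof (rule ccontr)
  assume n: "\<not> ?thesis"
  have sub: "\<C> \<subseteq> comps V E X" "\<D> \<subseteq> comps V E X"
    using assms unfolding tangle_ultrafilter_def by blast+
  have "(comps V E X - \<C>) \<inter> (comps V E X - \<D>) \<inter> (\<C> \<union> \<D>) \<in> \<U> X"
    using n sub by (intro ultra_inter ultra_compl assms) simp_all
  moreover have "(comps V E X - \<C>) \<inter> (comps V E X - \<D>) \<inter> (\<C> \<union> \<D>) = {}" by blast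
  ultimately show False using ultra_nonempty by simp
qed

text \<open>An ultrafilter contains a class of every finite partition of one of its members; the
  induction runs over the set of colours.\<close>

lemma ultra_finite_fibre:
  assumes "finite (c ` \<C>)" "\<C> \<in> \<U> X"
  obtains k where "{C \<in> \<C>. c C = k} \<in> \<U> X"
proof -
  have "\<exists>k. {C \<in> \<C>. c C = k} \<in> \<U> X"
    if "finite K" "{C \<in> \<C>. c C \<in> K} \<in> \<U> X" for K
    using that
  proof (induction K)
    case empty
    then show ?case using ultra_nonempty by simp
  next
    case (insert k K)
    have "{C \<in> \<C>. c C \<in> insert k K} = {C \<in> \<C>. c C = k} \<union> {C \<in> \<C>. c C \<in> K}" by blast
    then have "{C \<in> \<C>. c C = k} \<in> \<U> X \<or> {C \<in> \<C>. c C \<in> K} \<in> \<U> X"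
      using ultra_un insert.prems by simp
    then show ?case using insert.IH by blast
  qed
  moreover have "{C \<in> \<C>. c C \<in> c ` \<C>} = \<C>" by blast
  ultimately have "\<exists>k. {C \<in> \<C>. c C = k} \<in> \<U> X" using assms by simp
  then show thesis using that by blast
qed

end

end

text \<open>Otherwise the big sides would share only vertices of
  \<open>X \<union> Y\<close>.\<close>

lemma comp_sep_incompatible:
  assumes "\<tau> \<in> tangles V E" "comp_sep V X \<C> \<in> \<tau>" "comp_sep V Y \<D> \<in> \<tau>" "finite X" "finite Y"
  shows "\<Union>\<C> \<inter> \<Union>\<D> \<noteq> {}"
proof
  assume "\<Union>\<C> \<inter> \<Union>\<D> = {}"
  then have "(X \<union> \<Union>\<C>) \<inter> (Y \<union> \<Union>\<D>) \<subseteq> X \<union> Y" by blast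
  then have "finite ((X \<union> \<Union>\<C>) \<inter> (Y \<union> \<Union>\<D>))"
    by (rule finite_subset) (simp add: assms(4,5))
  then show False
    using tangle_inter_infinite[OF assms(1)] assms(2,3) unfolding comp_sep_def by blast
qed


section \<open>The location of an ultrafilter tangle\<close>

text \<open>Quantifying over \<open>F\<close> combines two facts: the full components at
  \<open>X\<close> form a large set (\<open>F = {}\<close>), and the ultrafilter is free.\<close>

definition located :: "'a osep set \<Rightarrow> 'a set \<Rightarrow> bool" where
  "located \<tau> X \<longleftrightarrow> \<tau> \<in> tangles V E \<and> finite X \<and> X \<subseteq> V \<and>
     (\<forall>F. finite F \<longrightarrow> full_comps X - F \<in> tangle_ultrafilter V E \<tau> X)"

text \<open>A finite \<open>X\<close> has finitely many subsets, so for some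
  \<open>Z \<subseteq> X\<close> the components with neighbourhood exactly \<open>Z\<close> form a
  large set. They are full components at \<open>Z\<close>, and the tangle is located there.\<close>

lemma ultrafilter_tangle_located:
  assumes "ultrafilter_tangle V E \<tau>"
  obtains Z where "located \<tau> Z"
proof -
  obtain X where X: "finite X" "X \<subseteq> V" and free: "\<Inter>(tangle_ultrafilter V E \<tau> X) = {}"
    and \<tau>: "\<tau> \<in> tangles V E"
    using assms unfolding ultrafilter_tangle_def by blast
  let ?U = "tangle_ultrafilter V E \<tau> X"
  note mono = ultra_mono[OF \<tau> X] and inter = ultra_inter[OF \<tau> X]
  have cofinite: "comps V E X - F \<in> ?U" if "finite F" for F
    using that
  proof (induction F)
    case empty
    \<comment> \<open>The intersection of the empty family is \<open>UNIV\<close>, so freeness also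
      provides a first member.\<close>
    have "?U \<noteq> {}" using free by auto
    then obtain \<C> where "\<C> \<in> ?U" by blast
    then show ?case using mono[of \<C> "comps V E X"] ultra_subset[OF \<tau> X] by simp
  next
    case (insert C F)
    have "C \<notin> \<Inter>?U" using free by simp
    then obtain \<C> where C: "\<C> \<in> ?U" "C \<notin> \<C>" by blast
    have "\<C> \<subseteq> comps V E X - {C}" using ultra_subset[OF \<tau> X C(1)] C(2) by blast
    then have "comps V E X - {C} \<in> ?U"
      by (rule mono[OF C(1)]) blast
    then have "(comps V E X - F) \<inter> (comps V E X - {C}) \<in> ?U"
      by (rule inter[OF insert.IH])
    moreover have "(comps V E X - F) \<inter> (comps V E X - {C}) = comps V E X - insert C F" by blast
    ultimately show ?case by simp
  qed
  let ?N = "\<lambda>C. {x \<in> X. \<exists>y\<in>C. {x, y} \<in> E}"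
  have "finite (?N ` comps V E X)"
    using X(1) by (auto intro: finite_subset[of _ "Pow X"])
  moreover have "comps V E X \<in> ?U" using cofinite[of "{}"] by simp
  ultimately obtain Z where Z: "{C \<in> comps V E X. ?N C = Z} \<in> ?U"
    using ultra_finite_fibre[OF \<tau> X] by blast
  let ?C = "{C \<in> comps V E X. ?N C = Z}"
  have "?C \<noteq> {}" using Z ultra_nonempty[OF \<tau> X] by metis
  then have ZX: "Z \<subseteq> X" by blast
  then have fZ: "finite Z" "Z \<subseteq> V" using X by (auto intro: finite_subset)
  have sub: "?C \<subseteq> full_comps Z"
  proof
    fix C assume C: "C \<in> ?C"
    then have "C \<in> comps V E Z"
      by (intro comps_shrink[OF _ ZX]) auto
    then show "C \<in> full_comps Z" using C unfolding full_comps_def by auto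
  qed
  have "full_comps Z - F \<in> tangle_ultrafilter V E \<tau> Z" if F: "finite F" for F
  proof -
    \<comment> \<open>A large set at \<open>X\<close> is carried over to \<open>Z\<close> by
      \<open>tangle_mono\<close>: the small side at \<open>Z\<close> meets its big side only within
      \<open>X\<close>.\<close>
    have "?C \<inter> (comps V E X - F) \<in> ?U" using inter Z cofinite[OF F] by blast
    then have "(V - \<Union>(?C \<inter> (comps V E X - F)), X \<union> \<Union>(?C \<inter> (comps V E X - F))) \<in> \<tau>"
      unfolding tangle_ultrafilter_def comp_sep_def by blast
    moreover have "(V - \<Union>(full_comps Z - F)) \<inter> (X \<union> \<Union>(?C \<inter> (comps V E X - F))) \<subseteq> X"
      using sub by blast
    then have "finite ((V - \<Union>(full_comps Z - F)) \<inter> (X \<union> \<Union>(?C \<inter> (comps V E X - F))))"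
      by (rule finite_subset) (rule X(1))
    moreover have "full_comps Z - F \<subseteq> comps V E Z" using full_comps_subset by blast
    ultimately show ?thesis
      using tangle_mono[OF \<tau>] fin_sep_comp_sep[OF fZ]
      unfolding tangle_ultrafilter_def comp_sep_def by blast
  qed
  then show thesis using that \<tau> fZ unfolding located_def by blast
qed

text \<open>Only finitely many components meet \<open>Y\<close>, and \<open>located\<close> allows
  finitely many to be discarded.\<close>

lemma located_avoiding:
  assumes "located \<tau> X" "finite Y"
  shows "{C \<in> full_comps X. C \<inter> Y = {}} \<in> tangle_ultrafilter V E \<tau> X"
proof -
  have "full_comps X - {C \<in> comps V E X. C \<inter> Y \<noteq> {}} \<in> tangle_ultrafilter V E \<tau> X"
    using assms finite_comps_meeting unfolding located_def by blast
  moreover have "full_comps X - {C \<in> comps V E X. C \<inter> Y \<noteq> {}} = {C \<in> full_comps X. C \<inter> Y = {}}"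
    using full_comps_subset by blast
  ultimately show ?thesis by simp
qed

text \<open>Infinitely many full components at \<open>Y\<close> avoid \<open>X\<close>, and each of them has a neighbour in
  \<open>C\<close>, hence lies inside \<open>C\<close>.\<close>

lemma located_in_component:
  assumes "located \<tau> Y" "finite X" "X \<subseteq> V" "C \<in> comps V E X" "C \<inter> Y \<noteq> {}"
  shows "{C} \<in> tangle_ultrafilter V E \<tau> X"
proof -
  let ?D = "{D \<in> full_comps Y. D \<inter> X = {}}"
  have Y: "\<tau> \<in> tangles V E" "finite Y" using assms(1) unfolding located_def by blast+
  obtain y where y: "y \<in> C" "y \<in> Y" using assms(5) by blast
  have sub: "D \<subseteq> C" if D: "D \<in> ?D" for D
  proof -
    obtain z where z: "z \<in> D" "{y, z} \<in> E" using D y unfolding full_comps_def by blast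
    have Dc: "D \<in> comps V E Y" using D full_comps_subset by blast
    then have "z \<in> C"
      using z D comps_edge_closed[OF assms(4) y(1) z(2)] comps_subset by blast
    then show ?thesis
      using comps_meet_subset[OF Dc _ assms(4)] D z by blast
  qed
  have "(V - \<Union>?D, Y \<union> \<Union>?D) \<in> \<tau>"
    using located_avoiding[OF assms(1,2)] unfolding tangle_ultrafilter_def comp_sep_def by blast
  moreover have "(V - \<Union>{C}) \<inter> (Y \<union> \<Union>?D) \<subseteq> Y" using sub by blast
  then have "finite ((V - \<Union>{C}) \<inter> (Y \<union> \<Union>?D))" by (rule finite_subset) (rule Y(2))
  moreover have "fin_sep (V - \<Union>{C}) (X \<union> \<Union>{C})"
    using fin_sep_comp_sep[of X "{C}"] assms by blast
  ultimately have "(V - \<Union>{C}, X \<union> \<Union>{C}) \<in> \<tau>"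
    using tangle_mono[OF Y(1)] by blast
  then show ?thesis using assms(4) unfolding tangle_ultrafilter_def comp_sep_def by blast
qed

text \<open>Induction over the generation of the topology. The main case is a set
  \<open>basic_open V E Y \<D>\<close>: almost every full component at \<open>X\<close> avoids
  \<open>Y\<close>, hence lies in one component of \<open>G - Y\<close>, and those inside
  \<open>\<Union>\<D>\<close> must be the large part.\<close>

lemma located_nhds:
  assumes loc: "located \<tau> X"
    and open_W: "openin (tangle_compactification V E) W" "Inr \<tau> \<in> W"
  obtains \<C> where "\<C> \<subseteq> full_comps X" "\<C> \<in> tangle_ultrafilter V E \<tau> X"
    "\<And>\<sigma>. \<sigma> \<in> tangles V E \<Longrightarrow> comp_sep V X \<C> \<in> \<sigma> \<Longrightarrow> Inr \<sigma> \<in> W"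
proof -
  have \<tau>: "\<tau> \<in> tangles V E" and X: "finite X" "X \<subseteq> V" using loc unfolding located_def by blast+
  let ?U = "tangle_ultrafilter V E \<tau> X"
  let ?P = "\<lambda>W. \<exists>\<C> \<subseteq> full_comps X. \<C> \<in> ?U \<and>
    (\<forall>\<sigma> \<in> tangles V E. comp_sep V X \<C> \<in> \<sigma> \<longrightarrow> Inr \<sigma> \<in> W)"
  have "generate_topology_on ({Inl ` U | U. openin (complex_topology V E) U} \<union>
      {basic_open V E X \<C> | X \<C>. finite X \<and> X \<subseteq> V \<and> \<C> \<subseteq> comps V E X}) W"
    using open_W(1) unfolding tangle_compactification_def openin_topology_generated_by_iff .
  then have "Inr \<tau> \<in> W \<longrightarrow> ?P W"
  proof induction
    case Empty
    then show ?case by simp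
  next
    case (Int W W')
    show ?case
    proof
      assume "Inr \<tau> \<in> W \<inter> W'"
      then have P: "?P W" "?P W'" using Int.IH by simp_all
      obtain \<C> where C: "\<C> \<subseteq> full_comps X" "\<C> \<in> ?U"
          "\<forall>\<sigma> \<in> tangles V E. comp_sep V X \<C> \<in> \<sigma> \<longrightarrow> Inr \<sigma> \<in> W"
        using P(1) by (elim exE conjE)
      obtain \<C>' where C': "\<C>' \<subseteq> full_comps X" "\<C>' \<in> ?U"
          "\<forall>\<sigma> \<in> tangles V E. comp_sep V X \<C>' \<in> \<sigma> \<longrightarrow> Inr \<sigma> \<in> W'"
        using P(2) by (elim exE conjE)
      have "Inr \<sigma> \<in> W \<inter> W'"
        if s: "\<sigma> \<in> tangles V E" "comp_sep V X (\<C> \<inter> \<C>') \<in> \<sigma>" for \<sigma>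
      proof -
        have "\<C> \<inter> \<C>' \<in> tangle_ultrafilter V E \<sigma> X"
          using s(2) C(1) full_comps_subset unfolding tangle_ultrafilter_def by blast
        then have "\<C> \<in> tangle_ultrafilter V E \<sigma> X" "\<C>' \<in> tangle_ultrafilter V E \<sigma> X"
          using C(1) C'(1) full_comps_subset by (auto elim!: ultra_mono[OF s(1) X])
        then show ?thesis
          using C(3) C'(3) s(1) unfolding tangle_ultrafilter_def by blast
      qed
      moreover have "\<C> \<inter> \<C>' \<in> ?U" by (rule ultra_inter[OF \<tau> X C(2) C'(2)])
      moreover have "\<C> \<inter> \<C>' \<subseteq> full_comps X" using C(1) by blast
      ultimately show "?P (W \<inter> W')" by (intro exI conjI ballI impI)
    qed
  next
    case (UN \<K>)
    show ?case
    proof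
      assume "Inr \<tau> \<in> \<Union>\<K>"
      then obtain W where W: "W \<in> \<K>" "Inr \<tau> \<in> W" by blast
      then have "?P W" using UN.IH by simp
      then obtain \<C> where C: "\<C> \<subseteq> full_comps X" "\<C> \<in> ?U"
          "\<forall>\<sigma> \<in> tangles V E. comp_sep V X \<C> \<in> \<sigma> \<longrightarrow> Inr \<sigma> \<in> W"
        by (elim exE conjE)
      then have "\<forall>\<sigma> \<in> tangles V E. comp_sep V X \<C> \<in> \<sigma> \<longrightarrow> Inr \<sigma> \<in> \<Union>\<K>" using W(1) by blast
      with C(1,2) show "?P (\<Union>\<K>)" by (intro exI conjI)
    qed
  next
    case (Basis W)
    show ?case
    proof
      assume "Inr \<tau> \<in> W"
      \<comment> \<open>Open sets of the 1-complex contain only \<open>Inl\<close> points, so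
        \<open>W\<close> is of the other kind.\<close>
      then obtain Y \<D> where W: "W = basic_open V E Y \<D>" and Y: "finite Y" "Y \<subseteq> V"
        and D: "\<D> \<subseteq> comps V E Y" "comp_sep V Y \<D> \<in> \<tau>"
        using Basis unfolding basic_open_def by auto
      define \<A> where "\<A> = {C \<in> full_comps X. C \<inter> Y = {}}"
      define \<C> where "\<C> = {C \<in> \<A>. C \<subseteq> \<Union>\<D>}"
      have "\<A> \<in> ?U" using located_avoiding loc Y(1) unfolding \<A>_def by blast
      moreover have "(\<A> - \<C>) \<union> \<C> = \<A>" unfolding \<C>_def by blast
      ultimately have "(\<A> - \<C>) \<union> \<C> \<in> ?U" by simp
      then have "\<A> - \<C> \<in> ?U \<or> \<C> \<in> ?U" by (rule ultra_un[OF \<tau> X])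
      moreover have "\<A> - \<C> \<notin> ?U"
      proof
        assume "\<A> - \<C> \<in> ?U"
        then have "comp_sep V X (\<A> - \<C>) \<in> \<tau>" unfolding tangle_ultrafilter_def by simp
        then have "\<Union>(\<A> - \<C>) \<inter> \<Union>\<D> \<noteq> {}"
          by (rule comp_sep_incompatible[OF \<tau> _ D(2) X(1) Y(1)])
        then obtain C D' where CD: "C \<in> \<A>" "C \<notin> \<C>" "D' \<in> \<D>" "C \<inter> D' \<noteq> {}" by blast
        have "C \<in> comps V E X" "C \<inter> Y = {}" using CD(1) full_comps_subset unfolding \<A>_def by blast+
        moreover have "D' \<in> comps V E Y" using CD(3) D(1) by blast
        ultimately have "C \<subseteq> D'" using comps_meet_subset CD(4) by simp
        then show False using CD(1-3) unfolding \<C>_def by blast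
      qed
      ultimately have C: "\<C> \<in> ?U" by simp
      have "Inr \<sigma> \<in> W" if s: "\<sigma> \<in> tangles V E" "comp_sep V X \<C> \<in> \<sigma>" for \<sigma>
      proof -
        \<comment> \<open>Every member of \<open>\<C>\<close> lies in \<open>\<Union>\<D>\<close>,
          so \<open>(X, \<C>)\<close> forces \<open>(Y, \<D>)\<close> in every tangle, not only in
          \<open>\<tau>\<close>.\<close>
        have "(V - \<Union>\<D>) \<inter> (X \<union> \<Union>\<C>) \<subseteq> X" unfolding \<C>_def by blast
        then have "finite ((V - \<Union>\<D>) \<inter> (X \<union> \<Union>\<C>))"
          by (rule finite_subset) (rule X(1))
        then have "comp_sep V Y \<D> \<in> \<sigma>"
          using tangle_mono[OF s(1) _ fin_sep_comp_sep[OF Y D(1)]] s(2) unfolding comp_sep_def by simp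
        then show ?thesis using s(1) W unfolding basic_open_def by blast
      qed
      moreover have "\<C> \<subseteq> full_comps X" unfolding \<C>_def \<A>_def by blast
      ultimately show "?P W" using C by (intro exI conjI ballI impI)
    qed
  qed
  then have "?P W" using open_W(2) by simp
  then obtain \<C> where "\<C> \<subseteq> full_comps X" "\<C> \<in> ?U"
      "\<forall>\<sigma> \<in> tangles V E. comp_sep V X \<C> \<in> \<sigma> \<longrightarrow> Inr \<sigma> \<in> W"
    by (elim exE conjE)
  then show thesis using that by simp
qed

section \<open>Tangles from prime ideals\<close>

text \<open>Members of \<open>K\<close> count as small: each separation is oriented towards the side
  that strictly contains all full components at \<open>X\<close> up to a small set.\<close>

lemma tangle_of_prime_ideal:
  assumes X: "finite X" "X \<subseteq> V"
    and K: "K \<subseteq> Pow (full_comps X)" "full_comps X \<notin> K"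
      "\<forall>S\<in>K. \<forall>T\<in>K. S \<union> T \<in> K" "\<forall>S\<in>K. \<forall>T\<subseteq>S. T \<in> K"
      "\<forall>S\<subseteq>full_comps X. S \<in> K \<or> full_comps X - S \<in> K"
      "\<And>S. finite S \<Longrightarrow> S \<subseteq> full_comps X \<Longrightarrow> S \<in> K"
  obtains \<tau> where "\<tau> \<in> tangles V E"
    "tangle_ultrafilter V E \<tau> X = {\<C>. \<C> \<subseteq> comps V E X \<and> full_comps X - \<C> \<in> K}"
proof -
  let ?M = "full_comps X"
  define out where "out A B = {C \<in> ?M. \<not> C \<subseteq> B - A}" for A B
  define \<tau> where "\<tau> = {(A, B). fin_sep A B \<and> out A B \<in> K}"
  have total: "out A B \<in> K \<or> out B A \<in> K" if s: "fin_sep A B" for A B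
  proof -
    let ?F = "{C \<in> ?M. C \<inter> (A \<inter> B) \<noteq> {}}"
    have "?F \<subseteq> {C \<in> comps V E X. C \<inter> (A \<inter> B) \<noteq> {}}" using full_comps_subset by blast
    moreover have "finite {C \<in> comps V E X. C \<inter> (A \<inter> B) \<noteq> {}}"
      using finite_comps_meeting s unfolding fin_sep_def by blast
    ultimately have "finite ?F" by (rule finite_subset)
    then have F: "?F \<in> K" using K(6)[of ?F] by blast
    \<comment> \<open>A component in neither strict side meets the separator, since otherwise one of
      its edges would cross the separation. There are finitely many such components.\<close>
    have "out A B \<inter> out B A \<subseteq> ?F"
    proof
      fix C assume C: "C \<in> out A B \<inter> out B A"
      show "C \<in> ?F"
      proof (rule ccontr)
        assume "C \<notin> ?F"
        then have e: "C \<inter> (A \<inter> B) = {}" and c: "C \<in> comps V E X" "C \<in> ?M"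
          using C full_comps_subset unfolding out_def by blast+
        have "C \<subseteq> A \<union> B" using comps_subset[OF c(1)] s unfolding fin_sep_def by blast
        moreover have "\<not> C \<subseteq> B - A" "\<not> C \<subseteq> A - B" using C unfolding out_def by blast+
        ultimately obtain a b where ab: "a \<in> C" "a \<in> A - B" "b \<in> C" "b \<in> B - A" using e by blast
        have "C \<subseteq> A - B"
        proof (rule comps_connected[OF c(1) ab(1,2)])
          fix x y assume xy: "x \<in> C" "x \<in> A - B" "y \<in> C" "{x, y} \<in> E"
          then have "y \<notin> B - A" using s unfolding fin_sep_def by blast
          then show "y \<in> A - B" using \<open>C \<subseteq> A \<union> B\<close> e xy by blast
        qed
        then show False using ab by blast
      qed
    qed
    then have meet: "out A B \<inter> out B A \<in> K" using K(4) F by blast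
    have M: "out A B \<subseteq> ?M" "out B A \<subseteq> ?M" unfolding out_def by blast+
    \<comment> \<open>By primality \<open>out B A\<close> or its complement is small, and that
      complement contains \<open>out A B\<close> up to the small overlap.\<close>
    show ?thesis
    proof (rule disjCI)
      assume "out B A \<notin> K"
      then have "?M - out B A \<in> K" using K(5) M by blast
      then have "(?M - out B A) \<union> (out A B \<inter> out B A) \<in> K" using K(3) meet by blast
      moreover have "out A B \<subseteq> (?M - out B A) \<union> (out A B \<inter> out B A)" using M by blast
      ultimately show "out A B \<in> K" using K(4) by blast
    qed
  qed
  \<comment> \<open>No component lies in two disjoint strict sides, so the two exceptional sets
    would cover \<open>?M\<close>. This yields both uniqueness of the orientation and
    consistency.\<close>
  have not_both: "\<not> (out A B \<in> K \<and> out C D \<in> K)" if "(B - A) \<inter> (D - C) = {}" for A B C D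
  proof
    assume "out A B \<in> K \<and> out C D \<in> K"
    then have "out A B \<union> out C D \<in> K" using K(3) by blast
    moreover have "out A B \<union> out C D = ?M"
      using that comps_nonempty full_comps_subset unfolding out_def by blast
    ultimately show False using K(2) by simp
  qed
  have "orientation_of (finite_order_seps V E) \<tau>"
    unfolding orientation_of_def
  proof (intro conjI ballI)
    fix r assume "r \<in> \<tau>"
    then show "unoriented r \<in> finite_order_seps V E"
      by (cases r) (simp add: \<tau>_def unoriented_def finite_order_seps_iff)
  next
    fix s assume "s \<in> finite_order_seps V E"
    then obtain A B where s: "s = {A, B}" "fin_sep A B"
      unfolding finite_order_seps_def fin_sep_def by blast
    have eq: "r = (A, B) \<or> r = (B, A)" if "unoriented r = s" for r
      using that s by (cases r) (auto simp: unoriented_def doubleton_eq_iff)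
    have excl: "\<not> ((A, B) \<in> \<tau> \<and> (B, A) \<in> \<tau>)"
      using not_both[of B A A B] unfolding \<tau>_def by blast
    have "(A, B) \<in> \<tau> \<or> (B, A) \<in> \<tau>"
      using total[OF s(2)] s(2) fin_sep_swap unfolding \<tau>_def by blast
    moreover have "unoriented (A, B) = s" "unoriented (B, A) = s"
      using s by (auto simp: unoriented_def)
    ultimately obtain r where r: "r \<in> \<tau>" "unoriented r = s" by blast
    show "\<exists>!r. r \<in> \<tau> \<and> unoriented r = s"
    proof (rule ex1I[of _ r])
      fix r' assume "r' \<in> \<tau> \<and> unoriented r' = s"
      then show "r' = r" using eq[of r] eq[of r'] r excl by auto
    qed (use r in simp)
  qed
  moreover have "consistent \<tau>"
    unfolding consistent_def
  proof (rule notI, elim exE conjE)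
    fix r s assume rs: "sep_less r s" "prod.swap r \<in> \<tau>" "s \<in> \<tau>"
    obtain A B C D where eq: "r = (A, B)" "s = (C, D)" by (cases r, cases s) auto
    have "(A - B) \<inter> (D - C) = {}"
      using rs(1) eq unfolding sep_less_def sep_le_def by auto
    then show False
      using not_both[of A B D C] rs eq unfolding \<tau>_def by auto
  qed
  moreover have "infinite (star_interior V \<sigma>)" if \<sigma>: "\<sigma> \<subseteq> \<tau>" "finite \<sigma>" for \<sigma>
  proof
    assume fin: "finite (star_interior V \<sigma>)"
    \<comment> \<open>The full components not inside every big side form a finite union of small
      sets. The rest are subsets of the finite interior, so they are finite in number, and
      \<open>?M\<close> would be small.\<close>
    have "{C \<in> ?M. \<exists>r\<in>\<sigma>. \<not> C \<subseteq> snd r} \<in> K"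
      using \<sigma>(2,1)
    proof (induction \<sigma>)
      case empty
      then show ?case using K(6)[of "{}"] by simp
    next
      case (insert r \<sigma>)
      obtain A B where r: "r = (A, B)" by (cases r)
      have "out A B \<union> {C \<in> ?M. \<exists>r\<in>\<sigma>. \<not> C \<subseteq> snd r} \<in> K"
        using K(3) insert r unfolding \<tau>_def by auto
      moreover have "{C \<in> ?M. \<exists>r\<in>insert r \<sigma>. \<not> C \<subseteq> snd r} \<subseteq>
          out A B \<union> {C \<in> ?M. \<exists>r\<in>\<sigma>. \<not> C \<subseteq> snd r}"
        unfolding out_def r by auto
      ultimately show ?case using K(4) by blast
    qed
    moreover have "{C \<in> ?M. \<forall>r\<in>\<sigma>. C \<subseteq> snd r} \<in> K"
    proof (rule K(6))
      have "{C \<in> ?M. \<forall>r\<in>\<sigma>. C \<subseteq> snd r} \<subseteq> Pow (star_interior V \<sigma>)"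
        using comps_subset full_comps_subset unfolding star_interior_def by blast
      then show "finite {C \<in> ?M. \<forall>r\<in>\<sigma>. C \<subseteq> snd r}"
        by (rule finite_subset) (simp add: fin)
    qed blast
    ultimately have "{C \<in> ?M. \<exists>r\<in>\<sigma>. \<not> C \<subseteq> snd r} \<union> {C \<in> ?M. \<forall>r\<in>\<sigma>. C \<subseteq> snd r} \<in> K"
      using K(3) by blast
    moreover have "{C \<in> ?M. \<exists>r\<in>\<sigma>. \<not> C \<subseteq> snd r} \<union> {C \<in> ?M. \<forall>r\<in>\<sigma>. C \<subseteq> snd r} = ?M" by blast
    ultimately show False using K(2) by simp
  qed
  ultimately have "\<tau> \<in> tangles V E"
    unfolding tangles_def aleph0_tangle_def by blast
  moreover have "comp_sep V X \<C> \<in> \<tau> \<longleftrightarrow> ?M - \<C> \<in> K" if C: "\<C> \<subseteq> comps V E X" for \<C>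
  proof -
    have "\<Union>\<C> \<subseteq> V" using C Union_comps by blast
    \<comment> \<open>The strict big side of \<open>(X, \<C>)\<close> is exactly
      \<open>\<Union>\<C>\<close>, so the exceptional components are those of
      \<open>?M - \<C>\<close>.\<close>
    then have eq: "(X \<union> \<Union>\<C>) - (V - \<Union>\<C>) = \<Union>\<C>" using X(2) by blast
    have "D \<subseteq> \<Union>\<C> \<longleftrightarrow> D \<in> \<C>" if D: "D \<in> ?M" for D
    proof
      assume s: "D \<subseteq> \<Union>\<C>"
      have D': "D \<in> comps V E X" using D full_comps_subset by blast
      then obtain x where "x \<in> D" using comps_nonempty by blast
      then show "D \<in> \<C>" using comps_disjoint[OF D'] C s by blast
    qed blast
    then have "out (V - \<Union>\<C>) (X \<union> \<Union>\<C>) = ?M - \<C>"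
      unfolding out_def eq by blast
    then show ?thesis
      using fin_sep_comp_sep[OF X C] unfolding \<tau>_def comp_sep_def by simp
  qed
  then have "tangle_ultrafilter V E \<tau> X = {\<C>. \<C> \<subseteq> comps V E X \<and> ?M - \<C> \<in> K}"
    unfolding tangle_ultrafilter_def by blast
  ultimately show thesis using that by blast
qed

section \<open>Separating discrete collections\<close>

lemma topspace_ultrafilter_tangle_space:
  "topspace (ultrafilter_tangle_space V E) = Inr ` ultrafilter_tangles V E"
proof -
  have "Inr ` ultrafilter_tangles V E \<subseteq> topspace (tangle_compactification V E)"
    unfolding topspace_tangle_compactification[OF simple] ultrafilter_tangles_def
      ultrafilter_tangle_def by auto
  then show ?thesis
    unfolding ultrafilter_tangle_space_def by auto
qed

lemma openin_basic_open:
  assumes "finite X" "X \<subseteq> V" "\<C> \<subseteq> comps V E X"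
  shows "openin (tangle_compactification V E) (basic_open V E X \<C>)"
  unfolding tangle_compactification_def
  by (rule topology_generated_by_Basis) (use assms in blast)

text \<open>Points of the 1-complex are compared by the support of their barycentric coordinates: in
  \<open>basic_open V E Z \<E>\<close> it meets \<open>\<Union>\<E>\<close> and lies in
  \<open>Z \<union> \<Union>\<E>\<close>. For tangles, \<open>comp_sep_incompatible\<close>
  applies.\<close>

lemma basic_open_disjoint:
  assumes "finite X" "finite Y"
    and disj: "\<Union>\<C> \<inter> \<Union>\<D> = {}" "\<Union>\<C> \<inter> Y = {}"
  shows "basic_open V E X \<C> \<inter> basic_open V E Y \<D> = {}"
proof -
  have meets: "\<exists>v\<in>\<Union>\<E>. p v \<noteq> 0" and supp: "\<forall>v. p v \<noteq> 0 \<longrightarrow> v \<in> Z \<union> \<Union>\<E>"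
    if "Inl p \<in> basic_open V E Z \<E>" for p Z \<E>
  proof -
    from that have "p \<in> (\<Union>C\<in>\<E>. complex_points C E) \<union> inner_edge_points E Z (\<Union>\<E>)"
      unfolding basic_open_def by auto
    then consider C w where "C \<in> \<E>" "w \<in> C" "p = vertex_point w"
      | C x y t where "C \<in> \<E>" "x \<in> C" "y \<in> C" "{x, y} \<in> E" "p = edge_point x y t"
      | x y t where "x \<in> Z" "y \<in> \<Union>\<E>" "0 < t" "t < 1" "p = edge_point x y t"
      unfolding complex_points_def inner_edge_points_def by blast
    then have "(\<exists>v\<in>\<Union>\<E>. p v \<noteq> 0) \<and> (\<forall>v. p v \<noteq> 0 \<longrightarrow> v \<in> Z \<union> \<Union>\<E>)"
    proof cases
      case 1
      then show ?thesis by (auto simp: vertex_point_def)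
    next
      case (2 C x y t)
      have "x \<noteq> y"
        using simple 2(4) unfolding simple_graph_def by (metis doubleton_eq_iff)
      then have "p x \<noteq> 0 \<or> p y \<noteq> 0" "\<forall>v. p v \<noteq> 0 \<longrightarrow> v = x \<or> v = y"
        using 2(5) by (auto simp: edge_point_def)
      then show ?thesis using 2(1-3) by blast
    next
      case (3 x y t)
      then have "p y \<noteq> 0" "\<forall>v. p v \<noteq> 0 \<longrightarrow> v = x \<or> v = y"
        by (auto simp: edge_point_def)
      then show ?thesis using 3(1,2) by blast
    qed
    then show "\<exists>v\<in>\<Union>\<E>. p v \<noteq> 0" "\<forall>v. p v \<noteq> 0 \<longrightarrow> v \<in> Z \<union> \<Union>\<E>" by blast+
  qed
  have "q \<notin> basic_open V E Y \<D>" if q: "q \<in> basic_open V E X \<C>" for q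
  proof (cases q)
    case (Inl p)
    show ?thesis
    proof
      assume "q \<in> basic_open V E Y \<D>"
      then have "\<forall>v. p v \<noteq> 0 \<longrightarrow> v \<in> Y \<union> \<Union>\<D>" using supp Inl by simp
      moreover obtain v where "v \<in> \<Union>\<C>" "p v \<noteq> 0" using meets[of p X \<C>] q Inl by blast
      ultimately have "v \<in> \<Union>\<C>" "v \<in> Y \<union> \<Union>\<D>" by blast+
      then show False using disj by blast
    qed
  next
    case (Inr \<tau>)
    then have \<tau>: "\<tau> \<in> tangles V E" "comp_sep V X \<C> \<in> \<tau>" using q unfolding basic_open_def by auto
    show ?thesis
    proof
      assume "q \<in> basic_open V E Y \<D>"
      then have "comp_sep V Y \<D> \<in> \<tau>" using Inr unfolding basic_open_def by auto
      then show False using comp_sep_incompatible[OF \<tau> _ assms(1,2)] disj(1) by simp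
    qed
  qed
  then show ?thesis by blast
qed

text \<open>The argument is by compactness: the sets of full components at \<open>X\<close> which admit such a
  colouring form an ideal, and an ultrafilter avoiding it would be an ultrafilter tangle without a
  neighbourhood meeting at most one member of the collection.\<close>

lemma discrete_collection_colouring:
  fixes A :: "'i \<Rightarrow> 'a tpoint set"
  assumes disc: "discrete_collection (ultrafilter_tangle_space V E) I A"
    and X: "finite X" "X \<subseteq> V"
  obtains F and c :: "'a set \<Rightarrow> 'i" where "finite F" "finite (c ` full_comps X)"
    "\<forall>i. \<forall>j\<in>I. \<forall>\<tau>. i \<noteq> j \<longrightarrow> Inr \<tau> \<in> A j \<longrightarrow>
      {C \<in> full_comps X - F. c C = i} \<notin> tangle_ultrafilter V E \<tau> X"
proof -
  let ?M = "full_comps X"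
  define colours where "colours S F c \<longleftrightarrow> finite F \<and> finite (c ` S) \<and>
      (\<forall>i. \<forall>j\<in>I. \<forall>\<tau>. i \<noteq> j \<longrightarrow> Inr \<tau> \<in> A j \<longrightarrow>
        {C \<in> S - F. c C = i} \<notin> tangle_ultrafilter V E \<tau> X)"
    for S F and c :: "'a set \<Rightarrow> 'i"
  have A: "\<tau> \<in> tangles V E" if "j \<in> I" "Inr \<tau> \<in> A j" for j \<tau>
    using disc that unfolding discrete_collection_def topspace_ultrafilter_tangle_space
      ultrafilter_tangles_def ultrafilter_tangle_def by blast
  define J where "J = {S. S \<subseteq> ?M \<and> (\<exists>F c. colours S F c)}"
  have J_down: "T \<in> J" if S: "S \<in> J" and T: "T \<subseteq> S" for S T
  proof -
    have SM: "S \<subseteq> ?M" using S unfolding J_def by blast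
    obtain F c where Fc: "colours S F c" using S unfolding J_def by blast
    have "{C \<in> T - F. c C = i} \<notin> tangle_ultrafilter V E \<tau> X"
      if j: "j \<in> I" "i \<noteq> j" "Inr \<tau> \<in> A j" for i j \<tau>
    proof
      assume a: "{C \<in> T - F. c C = i} \<in> tangle_ultrafilter V E \<tau> X"
      have "{C \<in> S - F. c C = i} \<in> tangle_ultrafilter V E \<tau> X"
        by (rule ultra_mono[OF A[OF j(1,3)] X a]) (use T SM full_comps_subset in blast)+
      then show False using Fc j unfolding colours_def by simp
    qed
    moreover have "finite (c ` T)"
      using Fc T finite_subset[OF image_mono] unfolding colours_def by metis
    ultimately have "colours T F c" using Fc unfolding colours_def by simp
    then show ?thesis using SM T unfolding J_def by blast
  qed
  have J_un: "S \<union> T \<in> J" if S: "S \<in> J" and T: "T \<in> J" for S T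
  proof -
    have SM: "S \<subseteq> ?M" "T \<subseteq> ?M" using S T unfolding J_def by blast+
    obtain F c where Fc: "colours S F c" using S unfolding J_def by blast
    obtain G d where Gd: "colours T G d" using T unfolding J_def by blast
    \<comment> \<open>On \<open>S\<close> the first colouring takes precedence. Each class of
      \<open>?e\<close> lies in the union of the two classes of that colour, and
      \<open>ultra_un\<close> selects one of them.\<close>
    let ?e = "\<lambda>C. if C \<in> S then c C else d C"
    have "{C \<in> (S \<union> T) - (F \<union> G). ?e C = i} \<notin> tangle_ultrafilter V E \<tau> X"
      if j: "j \<in> I" "i \<noteq> j" "Inr \<tau> \<in> A j" for i j \<tau>
    proof
      note \<tau> = A[OF j(1,3)]
      assume a: "{C \<in> (S \<union> T) - (F \<union> G). ?e C = i} \<in> tangle_ultrafilter V E \<tau> X"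
      have "{C \<in> S - F. c C = i} \<union> {C \<in> T - G. d C = i} \<in> tangle_ultrafilter V E \<tau> X"
        by (rule ultra_mono[OF \<tau> X a]) (use SM full_comps_subset in auto)
      then have "{C \<in> S - F. c C = i} \<in> tangle_ultrafilter V E \<tau> X \<or>
          {C \<in> T - G. d C = i} \<in> tangle_ultrafilter V E \<tau> X"
        by (rule ultra_un[OF \<tau> X])
      then show False using Fc Gd j unfolding colours_def by simp
    qed
    moreover have "finite (?e ` (S \<union> T))"
      by (rule finite_subset[of _ "c ` S \<union> d ` T"]) (use Fc Gd in \<open>auto simp: colours_def\<close>)
    ultimately have "colours (S \<union> T) (F \<union> G) ?e" using Fc Gd unfolding colours_def by simp
    then show ?thesis using SM unfolding J_def by blast
  qed
  have J_fin: "S \<in> J" if S: "finite S" "S \<subseteq> ?M" for S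
  proof -
    \<comment> \<open>With all of \<open>S\<close> discarded every class is empty;
      \<open>undefined\<close> merely supplies a colour.\<close>
    have "colours S S (\<lambda>_. undefined)"
      using S(1) ultra_nonempty[OF A X] unfolding colours_def by auto
    then show ?thesis using S(2) unfolding J_def by blast
  qed
  have "?M \<in> J"
  proof (rule ccontr)
    assume n: "?M \<notin> J"
    have J: "J \<subseteq> Pow ?M" "J \<noteq> {}" using J_fin[of "{}"] unfolding J_def by auto
    obtain K where JK: "J \<subseteq> K" and K: "K \<subseteq> Pow ?M" "?M \<notin> K"
        "\<forall>S\<in>K. \<forall>T\<in>K. S \<union> T \<in> K" "\<forall>S\<in>K. \<forall>T\<subseteq>S. T \<in> K"
        "\<forall>S\<subseteq>?M. S \<in> K \<or> ?M - S \<in> K"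
      using prime_ideal_exists[OF J(1) n J(2) J_un J_down] .
    have K_fin: "\<And>S. finite S \<Longrightarrow> S \<subseteq> ?M \<Longrightarrow> S \<in> K" using J_fin JK by blast
    obtain \<tau> where \<tau>: "\<tau> \<in> tangles V E"
        and U: "tangle_ultrafilter V E \<tau> X = {\<C>. \<C> \<subseteq> comps V E X \<and> ?M - \<C> \<in> K}"
      using tangle_of_prime_ideal[OF X K K_fin] .
    \<comment> \<open>The first form shows that \<open>\<tau>\<close> is located at
      \<open>X\<close>, the second that its ultrafilter at \<open>X\<close> is free.\<close>
    have cofinite: "?M - F \<in> tangle_ultrafilter V E \<tau> X" "comps V E X - F \<in> tangle_ultrafilter V E \<tau> X"
      if F: "finite F" for F
    proof -
      have "?M - (?M - F) \<in> K" "?M - (comps V E X - F) \<in> K"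
        using F full_comps_subset by (intro K_fin; auto intro: finite_subset[of _ F])+
      then show "?M - F \<in> tangle_ultrafilter V E \<tau> X" "comps V E X - F \<in> tangle_ultrafilter V E \<tau> X"
        unfolding U using full_comps_subset by auto
    qed
    have loc: "located \<tau> X"
      using \<tau> X cofinite(1) unfolding located_def by simp
    have "C \<notin> \<Inter>(tangle_ultrafilter V E \<tau> X)" for C
      using cofinite(2)[of "{C}"] by blast
    then have "\<Inter>(tangle_ultrafilter V E \<tau> X) = {}" by blast
    then have "Inr \<tau> \<in> topspace (ultrafilter_tangle_space V E)"
      unfolding topspace_ultrafilter_tangle_space ultrafilter_tangles_def ultrafilter_tangle_def
      using \<tau> X by blast
    then obtain W where W: "openin (ultrafilter_tangle_space V E) W" "Inr \<tau> \<in> W"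
        and one: "\<forall>i\<in>I. \<forall>j\<in>I. A i \<inter> W \<noteq> {} \<and> A j \<inter> W \<noteq> {} \<longrightarrow> i = j"
      using disc unfolding discrete_collection_def by meson
    obtain W' where W': "openin (tangle_compactification V E) W'"
        "W = W' \<inter> Inr ` ultrafilter_tangles V E"
      using W(1) unfolding ultrafilter_tangle_space_def openin_subtopology by blast
    then obtain \<C> where C: "\<C> \<subseteq> ?M" "\<C> \<in> tangle_ultrafilter V E \<tau> X"
        and sub: "\<And>\<sigma>. \<sigma> \<in> tangles V E \<Longrightarrow> comp_sep V X \<C> \<in> \<sigma> \<Longrightarrow> Inr \<sigma> \<in> W'"
      using located_nhds[OF loc W'(1)] W(2) by blast
    \<comment> \<open>\<open>k\<close> is the one index whose set meets \<open>W\<close>, and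
      arbitrary if there is none. Colouring all of \<open>\<C>\<close> with \<open>k\<close> puts
      \<open>\<C>\<close> into \<open>J \<subseteq> K\<close>, although its complement in
      \<open>?M\<close> is in \<open>K\<close> too.\<close>
    define k where "k = (SOME k. k \<in> I \<and> A k \<inter> W \<noteq> {})"
    have "{C \<in> \<C> - {}. k = i} \<notin> tangle_ultrafilter V E \<sigma> X"
      if j: "j \<in> I" "i \<noteq> j" "Inr \<sigma> \<in> A j" for i j \<sigma>
    proof
      note \<sigma> = A[OF j(1,3)]
      assume a: "{C \<in> \<C> - {}. k = i} \<in> tangle_ultrafilter V E \<sigma> X"
      then have ki: "k = i" using ultra_nonempty[OF \<sigma> X] by (cases "k = i") auto
      then have "comp_sep V X \<C> \<in> \<sigma>" using a unfolding tangle_ultrafilter_def by simp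
      then have "Inr \<sigma> \<in> W'" using sub \<sigma> by blast
      moreover have "Inr \<sigma> \<in> topspace (ultrafilter_tangle_space V E)"
        using disc j(1,3) unfolding discrete_collection_def by blast
      ultimately have "Inr \<sigma> \<in> W"
        unfolding W'(2) topspace_ultrafilter_tangle_space by blast
      then have jW: "A j \<inter> W \<noteq> {}" using j(3) by blast
      then have "\<exists>k. k \<in> I \<and> A k \<inter> W \<noteq> {}" using j(1) by blast
      then have "k \<in> I \<and> A k \<inter> W \<noteq> {}" unfolding k_def by (rule someI_ex)
      then have "k = j" using one jW j(1) by simp
      then show False using ki j(2) by simp
    qed
    moreover have "finite ((\<lambda>_. k) ` \<C>)" by (rule finite_subset[of _ "{k}"]) auto
    ultimately have "colours \<C> {} (\<lambda>_. k)" unfolding colours_def by simp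
    then have "\<C> \<in> K" using C(1) JK unfolding J_def by blast
    moreover have "?M - \<C> \<in> K" using C(2) unfolding U by blast
    ultimately have "\<C> \<union> (?M - \<C>) \<in> K" using K(3) by blast
    moreover have "\<C> \<union> (?M - \<C>) = ?M" using C(1) by blast
    ultimately show False using K(2) by simp
  qed
  then obtain F c where "colours ?M F c" unfolding J_def by blast
  then show thesis using that[of F c] unfolding colours_def by simp
qed

lemma discrete_collection_separated:
  fixes A :: "'i \<Rightarrow> 'a tpoint set"
  assumes disc: "discrete_collection (ultrafilter_tangle_space V E) I A"
  obtains U where "\<And>i. i \<in> I \<Longrightarrow> openin (tangle_compactification V E) (U i)"
    "\<And>i. i \<in> I \<Longrightarrow> A i \<subseteq> U i" "disjoint_family_on U I"
proof -
  have ultra: "\<exists>\<tau>. p = Inr \<tau> \<and> ultrafilter_tangle V E \<tau>" if "i \<in> I" "p \<in> A i" for i p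
    using disc that
    unfolding discrete_collection_def topspace_ultrafilter_tangle_space ultrafilter_tangles_def
    by blast
  define colours where "colours X F c \<longleftrightarrow> finite F \<and> finite (c ` full_comps X) \<and>
      (\<forall>i. \<forall>j\<in>I. \<forall>\<tau>. i \<noteq> j \<longrightarrow> Inr \<tau> \<in> A j \<longrightarrow>
        {C \<in> full_comps X - F. c C = i} \<notin> tangle_ultrafilter V E \<tau> X)"
    for X F and c :: "'a set \<Rightarrow> 'i"
  have "\<exists>F c. colours X F c" if X: "finite X" "X \<subseteq> V" for X
  proof -
    obtain F and c :: "'a set \<Rightarrow> 'i" where "finite F" "finite (c ` full_comps X)"
      "\<forall>i. \<forall>j\<in>I. \<forall>\<tau>. i \<noteq> j \<longrightarrow> Inr \<tau> \<in> A j \<longrightarrow>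
        {C \<in> full_comps X - F. c C = i} \<notin> tangle_ultrafilter V E \<tau> X"
      using discrete_collection_colouring[OF disc X] .
    then have "colours X F c" unfolding colours_def by simp
    then show ?thesis by blast
  qed
  then obtain F c where Fc: "\<And>X. finite X \<Longrightarrow> X \<subseteq> V \<Longrightarrow> colours X (F X) (c X)"
    by metis
  define \<K> where "\<K> X i = {C \<in> full_comps X - F X. c X C = i}" for X i
  have \<K>: "\<K> X i \<subseteq> full_comps X" "\<K> X i \<subseteq> comps V E X" for X i
    using full_comps_subset unfolding \<K>_def by blast+
  have other: "\<K> X i \<notin> tangle_ultrafilter V E \<tau> X"
    if "finite X" "X \<subseteq> V" "j \<in> I" "i \<noteq> j" "Inr \<tau> \<in> A j" for X i j \<tau>
    using Fc[OF that(1,2)] that(3-) unfolding colours_def \<K>_def by blast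
  \<comment> \<open>Restricting to these \<open>X\<close> supplies, for each
    \<open>Y \<in> \<X> j\<close>, a tangle of \<open>A j\<close> located at \<open>Y\<close>; this
    witness drives \<open>avoid\<close>.\<close>
  define \<X> where "\<X> i = {X. \<exists>\<tau>. Inr \<tau> \<in> A i \<and> located \<tau> X}" for i
  have \<X>: "finite X" "X \<subseteq> V" if "X \<in> \<X> i" for X i
    using that unfolding \<X>_def located_def by blast+
  define U where "U i = (\<Union>X\<in>\<X> i. basic_open V E X (\<K> X i))" for i
  have "openin (tangle_compactification V E) (U i)" for i
    unfolding U_def using openin_basic_open[OF \<X> \<K>(2)] by (intro openin_Union) auto
  moreover have "A i \<subseteq> U i" if i: "i \<in> I" for i
  proof
    fix p assume p: "p \<in> A i"
    then obtain \<tau> where \<tau>: "p = Inr \<tau>" "ultrafilter_tangle V E \<tau>" using ultra i by blast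
    obtain X where loc: "located \<tau> X" using ultrafilter_tangle_located[OF \<tau>(2)] .
    then have X: "\<tau> \<in> tangles V E" "finite X" "X \<subseteq> V" unfolding located_def by blast+
    have F: "finite (F X)" "finite (c X ` full_comps X)" using Fc X unfolding colours_def by simp_all
    have large: "full_comps X - F X \<in> tangle_ultrafilter V E \<tau> X"
      using loc F(1) unfolding located_def by simp
    have "finite (c X ` (full_comps X - F X))"
      by (rule finite_subset[OF image_mono F(2)]) blast
    \<comment> \<open>There are finitely many colours, so one class is large for
      \<open>\<tau>\<close>; \<open>other\<close> rules out every colour except
      \<open>i\<close>.\<close>
    then obtain k where "\<K> X k \<in> tangle_ultrafilter V E \<tau> X"
      unfolding \<K>_def using ultra_finite_fibre[OF X _ large] by blast
    moreover from this have "k = i" using other[OF X(2,3) i] p \<tau>(1) by blast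
    ultimately have "comp_sep V X (\<K> X i) \<in> \<tau>" unfolding tangle_ultrafilter_def by blast
    then have "p \<in> basic_open V E X (\<K> X i)" using X(1) \<tau>(1) unfolding basic_open_def by blast
    moreover have "X \<in> \<X> i" using loc p \<tau>(1) unfolding \<X>_def by blast
    ultimately show "p \<in> U i" unfolding U_def by blast
  qed
  moreover have "disjoint_family_on U I"
  proof -
    have avoid: "C \<inter> Y = {}"
      if ij: "i \<noteq> j" "j \<in> I" and XY: "X \<in> \<X> i" "Y \<in> \<X> j" and C: "C \<in> \<K> X i" for i j X Y C
    proof (rule ccontr)
      assume "C \<inter> Y \<noteq> {}"
      moreover obtain \<tau> where \<tau>: "Inr \<tau> \<in> A j" "located \<tau> Y" using XY(2) unfolding \<X>_def by blast
      moreover have "C \<in> comps V E X" using C \<K>(2) by blast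
      ultimately have "{C} \<in> tangle_ultrafilter V E \<tau> X"
        using located_in_component \<X>[OF XY(1)] by blast
      moreover have "\<tau> \<in> tangles V E" using \<tau>(2) unfolding located_def by blast
      ultimately have "\<K> X i \<in> tangle_ultrafilter V E \<tau> X"
        using ultra_mono[OF _ \<X>[OF XY(1)]] C \<K>(2) by blast
      then show False using other[OF \<X>[OF XY(1)] ij(2,1) \<tau>(1)] by blast
    qed
    have "basic_open V E X (\<K> X i) \<inter> basic_open V E Y (\<K> Y j) = {}"
      if ij: "i \<in> I" "j \<in> I" "i \<noteq> j" and XY: "X \<in> \<X> i" "Y \<in> \<X> j" for i j X Y
    proof (rule basic_open_disjoint)
      show "\<Union>(\<K> X i) \<inter> Y = {}" using avoid[OF ij(3,2) XY] by blast
      \<comment> \<open>At the same \<open>X\<close> the colours differ, so the components do. At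
        different sets, \<open>avoid\<close> in both directions gives the mutual avoidance that
        \<open>full_comps_disjoint\<close> requires.\<close>
      have "C \<inter> D = {}" if CD: "C \<in> \<K> X i" "D \<in> \<K> Y j" for C D
      proof (cases "X = Y")
        case True
        then have "C \<noteq> D" using CD ij(3) unfolding \<K>_def by blast
        moreover have "C \<in> comps V E X" "D \<in> comps V E X" using CD \<K>(2) True by blast+
        ultimately show ?thesis using comps_disjoint by blast
      next
        case False
        have "C \<in> full_comps X" "D \<in> full_comps Y" using CD \<K>(1) by blast+
        moreover have "C \<inter> Y = {}" using avoid[OF ij(3,2) XY CD(1)] .
        moreover have "D \<inter> X = {}" using avoid[OF ij(3)[symmetric] ij(1) XY(2,1) CD(2)] .
        ultimately show ?thesis
          using full_comps_disjoint \<X>(2)[OF XY(1)] \<X>(2)[OF XY(2)] False by simp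
      qed
      then show "\<Union>(\<K> X i) \<inter> \<Union>(\<K> Y j) = {}" by blast
    qed (use \<X> XY in blast)+
    then show ?thesis
      unfolding disjoint_family_on_def U_def by blast
  qed
  ultimately show thesis using that by blast
qed

section \<open>Closed points and collectionwise normality\<close>

text \<open>Distinct tangles orient some separation differently; written as
  \<open>(X, \<C>)\<close>, it gives a neighbourhood of \<open>z\<close> that misses
  \<open>y\<close>.\<close>

lemma closedin_singleton:
  assumes y: "y \<in> topspace (ultrafilter_tangle_space V E)"
  shows "closedin (ultrafilter_tangle_space V E) {y}"
proof -
  obtain \<tau> where \<tau>: "y = Inr \<tau>" "\<tau> \<in> tangles V E"
    using y unfolding topspace_ultrafilter_tangle_space ultrafilter_tangles_def
      ultrafilter_tangle_def by blast
  have "\<exists>T. openin (ultrafilter_tangle_space V E) T \<and> z \<in> T \<and>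
      T \<subseteq> topspace (ultrafilter_tangle_space V E) - {y}"
    if z: "z \<in> topspace (ultrafilter_tangle_space V E) - {y}" for z
  proof -
    obtain \<sigma> where \<sigma>: "z = Inr \<sigma>" "\<sigma> \<in> tangles V E" "\<sigma> \<noteq> \<tau>"
      using z \<tau>(1) unfolding topspace_ultrafilter_tangle_space ultrafilter_tangles_def
        ultrafilter_tangle_def by blast
    obtain A B where AB: "(A, B) \<in> \<sigma>" "(A, B) \<notin> \<tau>"
    proof -
      have "\<exists>r. r \<in> \<sigma> \<and> r \<notin> \<tau>"
      proof (rule ccontr)
        assume "\<nexists>r. r \<in> \<sigma> \<and> r \<notin> \<tau>"
        then have "\<sigma> \<subseteq> \<tau>" by blast
        \<comment> \<open>A proper inclusion is impossible: \<open>\<sigma>\<close> would contain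
          the inverse of some member of \<open>\<tau>\<close>, so \<open>\<tau>\<close> would
          contain both orientations, whose big sides meet in a finite set.\<close>
        moreover have "(A, B) \<in> \<sigma>" if "(A, B) \<in> \<tau>" for A B
        proof (rule ccontr)
          assume "(A, B) \<notin> \<sigma>"
          then have "(B, A) \<in> \<tau>"
            using tangle_orient[OF \<sigma>(2)] tangle_fin_sep[OF \<tau>(2) that] \<open>\<sigma> \<subseteq> \<tau>\<close> by blast
          then have "infinite (B \<inter> A)" using tangle_inter_infinite[OF \<tau>(2) that] by blast
          then show False
            using tangle_fin_sep[OF \<tau>(2) that] unfolding fin_sep_def by (simp add: Int_commute)
        qed
        ultimately show False using \<sigma>(3) by auto
      qed
      then show thesis using that by auto
    qed
    let ?X = "A \<inter> B" and ?\<C> = "{C \<in> comps V E (A \<inter> B). C \<subseteq> B}"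
    let ?W = "basic_open V E ?X ?\<C>"
    have s: "fin_sep A B" using tangle_fin_sep \<sigma>(2) AB(1) by blast
    then have eq: "comp_sep V ?X ?\<C> = (A, B)" by (rule comp_sep_cases)
    have "openin (tangle_compactification V E) ?W"
      using s unfolding fin_sep_def by (intro openin_basic_open) auto
    then have "openin (ultrafilter_tangle_space V E) (?W \<inter> Inr ` ultrafilter_tangles V E)"
      unfolding ultrafilter_tangle_space_def openin_subtopology by blast
    moreover have "z \<in> ?W \<inter> Inr ` ultrafilter_tangles V E"
      using z \<sigma> AB(1) eq unfolding topspace_ultrafilter_tangle_space basic_open_def by auto
    moreover have "y \<notin> ?W" using \<tau>(1) AB(2) eq unfolding basic_open_def by auto
    then have "?W \<inter> Inr ` ultrafilter_tangles V E \<subseteq> topspace (ultrafilter_tangle_space V E) - {y}"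
      unfolding topspace_ultrafilter_tangle_space by blast
    ultimately show ?thesis by blast
  qed
  then have "openin (ultrafilter_tangle_space V E) (topspace (ultrafilter_tangle_space V E) - {y})"
    by (subst openin_subopen) blast
  then show ?thesis using y unfolding closedin_def by blast
qed

text \<open>The separating open sets of the compactification are traced on the subspace, each
  collection being indexed by itself.\<close>

lemma collectionwise_normal_ultrafilter_tangle_space:
  "collectionwise_normal (ultrafilter_tangle_space V E)"
  unfolding collectionwise_normal_def
proof (intro conjI ballI allI impI)
  fix \<A> assume "discrete_collection (ultrafilter_tangle_space V E) \<A> (\<lambda>A. A) \<and>
    disjoint_family_on (\<lambda>A. A) \<A> \<and> (\<forall>A\<in>\<A>. closedin (ultrafilter_tangle_space V E) A)"
  then have disc: "discrete_collection (ultrafilter_tangle_space V E) \<A> (\<lambda>A. A)" by blast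
  then obtain U where U: "\<And>A. A \<in> \<A> \<Longrightarrow> openin (tangle_compactification V E) (U A)"
      "\<And>A. A \<in> \<A> \<Longrightarrow> A \<subseteq> U A" "disjoint_family_on U \<A>"
    using discrete_collection_separated by blast
  let ?U = "\<lambda>A. U A \<inter> Inr ` ultrafilter_tangles V E"
  have "openin (ultrafilter_tangle_space V E) (?U A) \<and> A \<subseteq> ?U A" if A: "A \<in> \<A>" for A
  proof
    show "openin (ultrafilter_tangle_space V E) (?U A)"
      using U(1)[OF A] unfolding ultrafilter_tangle_space_def openin_subtopology by blast
    show "A \<subseteq> ?U A"
      using U(2)[OF A] disc A
      unfolding discrete_collection_def topspace_ultrafilter_tangle_space by simp
  qed
  moreover have "disjoint_family_on ?U \<A>"
    using U(3) unfolding disjoint_family_on_def by blast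
  ultimately show "\<exists>U. (\<forall>A\<in>\<A>. openin (ultrafilter_tangle_space V E) (U A) \<and> A \<subseteq> U A) \<and>
      disjoint_family_on U \<A>"
    by (intro exI[of _ ?U]) simp
qed (rule closedin_singleton)

end

theorem theorem3:
  fixes V :: "'a set" and E :: "'a set set"
  assumes "simple_graph V E" and "connected_graph V E"
  shows "(\<forall>(I :: 'i set) (A :: 'i \<Rightarrow> 'a tpoint set).
            discrete_collection (ultrafilter_tangle_space V E) I A \<and>
            disjoint_family_on A I \<and>
            (\<forall>i\<in>I. closedin (ultrafilter_tangle_space V E) (A i)) \<longrightarrow>
            (\<exists>U :: 'i \<Rightarrow> 'a tpoint set.
               (\<forall>i\<in>I. openin (tangle_compactification V E) (U i) \<and> A i \<subseteq> U i) \<and>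
               disjoint_family_on U I)) \<and>
         collectionwise_normal (ultrafilter_tangle_space V E)"
proof -
  interpret graph V E by (rule graph.intro) (rule assms(1))
  have "\<exists>U :: 'i \<Rightarrow> 'a tpoint set.
      (\<forall>i\<in>I. openin (tangle_compactification V E) (U i) \<and> A i \<subseteq> U i) \<and> disjoint_family_on U I"
    if "discrete_collection (ultrafilter_tangle_space V E) I A"
    for I :: "'i set" and A :: "'i \<Rightarrow> 'a tpoint set"
    using discrete_collection_separated[OF that] by metis
  then show ?thesis
    using collectionwise_normal_ultrafilter_tangle_space by blast
qed

end
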